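(* Let $\{S_i\}_{i=1}^m$ be an SS-IFS in $\mathbb{R}^d$ with attractor $K$ containing at least two points and transformation group $\mathcal{T}$. For all $\varepsilon>0$ there exists an SS-IFS $\{\widehat{S_i}\}_{i=1}^{\widehat{m}}$ in $\mathbb{R}^d$ that satisfies the SSC, with attractor $\widehat{K}$, such that $\widehat{K}\subseteq K$, $\dim_H K-\varepsilon<\dim_H\widehat{K}$, and the transformation group $\widehat{\mathcal{T}}$ of $\{\widehat{S_i}\}_{i=1}^{\widehat{m}}$ is dense in $\mathcal{T}$ (that is, $\widehat{\mathcal{T}}$ is a dense subset of $\mathcal{T}$).
   Context: $\dim_H$ denotes Hausdorff dimension. The group $\mathbb{O}_d$ of orthogonal transformations of $\mathbb{R}^d$ is metrized by the Euclidean operator norm. A self-similar iterated function system (SS-IFS) in $\mathbb{R}^d$ is a finite collection $\{S_i\}_{i=1}^m$ of contracting similarities of $\mathbb{R}^d$, written uniquely as $S_i(x)=r_iT_i(x)+v_i$ with $0<r_i<1$, $T_i\in\mathbb{O}_d$ and $v_i\in\mathbb{R}^d$. Its attractor is the unique nonempty compact $K$ with $K=\bigcup_{i=1}^m S_i(K)$. Its transformation group is the group generated by $T_1,\ldots,T_m$. The SS-IFS satisfies the strong separation condition (SSC) if the union $\bigcup_{i=1}^m S_i(K)$ is disjoint, i.e. $S_i(K)\cap S_j(K)=\emptyset$ for $i\ne j$. *)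

theory Defs
  imports "HOL-Analysis.Analysis" "HOL-Algebra.Generated_Groups"
begin

section \<open>Hausdorff measure and Hausdorff dimension\<close>

text \<open>
  At exponent \<open>0\<close> a nonempty set (a singleton included) has weight \<open>1\<close>, so that the
  \<open>0\<close>-dimensional measure counts points; note that \<open>0 powr 0 = 0\<close>.
\<close>

definition diam_pow :: "real \<Rightarrow> 'a::metric_space set \<Rightarrow> ennreal" where
  "diam_pow s U = (if U = {} then 0 else if s = 0 then 1 else ennreal (diameter U powr s))"

text \<open>
  Boundedness is required explicitly because \<^const>\<open>diameter\<close> has no meaningful value
  on unbounded sets. Finite covers are included, as \<open>U n\<close> may be empty.
\<close>

definition delta_cover :: "real \<Rightarrow> 'a::metric_space set \<Rightarrow> (nat \<Rightarrow> 'a set) \<Rightarrow> bool" where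
  "delta_cover \<delta> A U \<longleftrightarrow> (\<forall>n. bounded (U n) \<and> diameter (U n) \<le> \<delta>) \<and> A \<subseteq> (\<Union>n. U n)"

definition hausdorff_premeasure :: "real \<Rightarrow> real \<Rightarrow> 'a::metric_space set \<Rightarrow> ennreal" where
  "hausdorff_premeasure s \<delta> A = (INF U\<in>{U. delta_cover \<delta> A U}. \<Sum>n. diam_pow s (U n))"

definition hausdorff_measure :: "real \<Rightarrow> 'a::metric_space set \<Rightarrow> ennreal" where
  "hausdorff_measure s A = (SUP \<delta>\<in>{0<..}. hausdorff_premeasure s \<delta> A)"

definition hausdorff_dim :: "'a::metric_space set \<Rightarrow> ereal" where
  "hausdorff_dim A = (INF s\<in>{s. 0 \<le> s \<and> hausdorff_measure s A = 0}. ereal s)"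


section \<open>The orthogonal group\<close>

text \<open>
  Orthogonal transformations are elements of the type of bounded linear maps, whose norm is the
  operator norm; thus \<^const>\<open>dist\<close> and \<^const>\<open>closure\<close> refer to the operator norm metric.
\<close>

definition orthogonal_group :: "('a::euclidean_space \<Rightarrow>\<^sub>L 'a) monoid" where
  "orthogonal_group =
    \<lparr>carrier = {f. orthogonal_transformation (blinfun_apply f)}, mult = (o\<^sub>L), one = id_blinfun\<rparr>"

lemma group_orthogonal_group: "group (orthogonal_group :: ('a::euclidean_space \<Rightarrow>\<^sub>L 'a) monoid)"
proof (rule groupI)
  fix f :: "'a \<Rightarrow>\<^sub>L 'a"
  assume "f \<in> carrier orthogonal_group"
  then have f: "orthogonal_transformation (blinfun_apply f)"
    by (simp add: orthogonal_group_def)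
  define g where "g = Blinfun (inv_into UNIV (blinfun_apply f))"
  have inv: "orthogonal_transformation (inv_into UNIV (blinfun_apply f))"
    using orthogonal_transformation_inv[OF f] .
  then have g: "blinfun_apply g = inv_into UNIV (blinfun_apply f)"
    unfolding g_def
    by (intro bounded_linear_Blinfun_apply linear_conv_bounded_linear[THEN iffD1]
        orthogonal_transformation_linear)
  have "g o\<^sub>L f = id_blinfun"
    using orthogonal_transformation_inj[OF f] by (intro blinfun_eqI) (simp add: g)
  moreover have "orthogonal_transformation (blinfun_apply g)"
    using inv unfolding g .
  ultimately show
    "\<exists>g\<in>carrier orthogonal_group. g \<otimes>\<^bsub>orthogonal_group\<^esub> f = \<one>\<^bsub>orthogonal_group\<^esub>"
    unfolding orthogonal_group_def by auto
qed (auto simp: orthogonal_group_def orthogonal_transformation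
    blinfun.bounded_linear_right bounded_linear.linear intro!: blinfun_eqI)

definition dense_subset_of :: "'a::topological_space set \<Rightarrow> 'a set \<Rightarrow> bool" where
  "dense_subset_of H G \<longleftrightarrow> H \<subseteq> G \<and> G \<subseteq> closure H"


section \<open>Self-similar iterated function systems\<close>

text \<open>
  A similarity is given by the data \<open>(r, T, v)\<close> of its decomposition \<open>x \<mapsto> r T(x) + v\<close>, which the
  map determines uniquely (\<open>sim_map_inject\<close> below).
\<close>

record (overloaded) 'a sim =
  sim_ratio :: real
  sim_orth :: "'a::euclidean_space \<Rightarrow>\<^sub>L 'a"
  sim_shift :: 'a

definition sim_map :: "('a::euclidean_space) sim \<Rightarrow> 'a \<Rightarrow> 'a" where
  "sim_map S x = sim_ratio S *\<^sub>R blinfun_apply (sim_orth S) x + sim_shift S"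

definition contracting_similarity :: "('a::euclidean_space) sim \<Rightarrow> bool" where
  "contracting_similarity S \<longleftrightarrow> 0 < sim_ratio S \<and> sim_ratio S < 1 \<and> sim_orth S \<in> carrier orthogonal_group"

lemma sim_map_inject:
  fixes S S' :: "('a::euclidean_space) sim"
  assumes S: "contracting_similarity S" and S': "contracting_similarity S'"
    and eq: "sim_map S = sim_map S'"
  shows "S = S'"
proof -
  have trans: "sim_shift S = sim_shift S'"
    using fun_cong[OF eq, of 0] by (simp add: sim_map_def)
  have lin: "sim_ratio S *\<^sub>R blinfun_apply (sim_orth S) x = sim_ratio S' *\<^sub>R blinfun_apply (sim_orth S') x" for x
    using fun_cong[OF eq, of x] trans by (simp add: sim_map_def)
  obtain b :: 'a where b: "b \<in> Basis"
    using nonempty_Basis by blast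
  have "norm (blinfun_apply (sim_orth S) b) = 1" "norm (blinfun_apply (sim_orth S') b) = 1"
    using S S' b by (auto simp: contracting_similarity_def orthogonal_group_def orthogonal_transformation)
  then have ratio: "sim_ratio S = sim_ratio S'"
    using arg_cong[OF lin[of b], of norm] S S' by (simp add: contracting_similarity_def)
  have "sim_orth S = sim_orth S'"
    using lin S' by (intro blinfun_eqI) (simp add: ratio contracting_similarity_def)
  with ratio trans show ?thesis
    by (cases S, cases S') simp
qed

text \<open>
  A system is a nonempty list of similarities, i.e. a family indexed by \<open>0, \<dots>, m - 1\<close>;
  repetitions are allowed in general, but violate the strong separation condition.
\<close>

definition ss_ifs :: "('a::euclidean_space) sim list \<Rightarrow> bool" where
  "ss_ifs \<S> \<longleftrightarrow> \<S> \<noteq> [] \<and> (\<forall>S\<in>set \<S>. contracting_similarity S)"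

definition is_attractor :: "('a::euclidean_space) sim list \<Rightarrow> 'a set \<Rightarrow> bool" where
  "is_attractor \<S> K \<longleftrightarrow> K \<noteq> {} \<and> compact K \<and> K = (\<Union>i<length \<S>. sim_map (\<S> ! i) ` K)"

definition transformation_group :: "('a::euclidean_space) sim list \<Rightarrow> ('a \<Rightarrow>\<^sub>L 'a) set" where
  "transformation_group \<S> = generate orthogonal_group (sim_orth ` set \<S>)"

definition strong_separation :: "('a::euclidean_space) sim list \<Rightarrow> 'a set \<Rightarrow> bool" where
  "strong_separation \<S> K \<longleftrightarrow>
    (\<forall>i<length \<S>. \<forall>j<length \<S>. i \<noteq> j \<longrightarrow> sim_map (\<S> ! i) ` K \<inter> sim_map (\<S> ! j) ` K = {})"

end

theory Submission
  imports Defs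
begin

text \<open>
  The transformation group is recovered exactly: if both \<open>C\<close> and \<open>S \<circ> C\<close> belong to the new
  system, then the orthogonal part of \<open>S\<close> is the quotient of theirs. Choosing for every generator
  \<open>S\<close> a point \<open>p\<^sub>S \<in> K\<close> such that all the points \<open>p\<^sub>S\<close> and \<open>S p\<^sub>S\<close> are distinct, and a
  sufficiently small cylinder \<open>C(K)\<close> containing \<open>p\<^sub>S\<close>, makes all sets \<open>C(K)\<close> and \<open>S(C(K))\<close>
  disjoint. A further cylinder disjoint from these is filled with so many small disjoint cylinders
  that the similarity dimension exceeds \<open>dim K - \<epsilon>\<close>.
\<close>

section \<open>Similarities and their compositions\<close>

text \<open>The maps of the original system may overlap in any way, so its similarity dimension is
  only an upper bound for the dimension of K, and a subsystem chosen for disjointness alone can lose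
  generators of the group. The two demands do not compete: the group needs only finitely many
  cylinders, however small, and the sums of \<open>sim_ratio C powr t\<close> over disjoint families
  of cylinders are unbounded for every nonnegative t below the dimension of K. Hence squeezing such
  a family into one fixed cylinder U, at the price of the factor \<open>sim_ratio U powr t\<close>,
  still leaves a sum of at least 1. No measure is built on the new attractor: its dimension is
  bounded below by a direct estimate for finite covers, to which countable covers are reduced by
  compactness. Since the two groups come out equal, the metric on the orthogonal group enters only
  through the fact that a set lies in its closure.\<close>

definition similarity :: "('a::euclidean_space) sim \<Rightarrow> bool" where
  "similarity S \<longleftrightarrow> 0 < sim_ratio S \<and> sim_orth S \<in> carrier orthogonal_group"

text \<open>The composite of the empty word. It is not contracting, which is why
  \<open>similarity\<close> puts no upper bound on the ratio.\<close>

definition sim_id :: "('a::euclidean_space) sim" where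
  "sim_id = \<lparr>sim_ratio = 1, sim_orth = id_blinfun, sim_shift = 0\<rparr>"

definition sim_comp :: "('a::euclidean_space) sim \<Rightarrow> 'a sim \<Rightarrow> 'a sim" where
  "sim_comp S R = \<lparr>sim_ratio = sim_ratio S * sim_ratio R, sim_orth = sim_orth S o\<^sub>L sim_orth R,
    sim_shift = sim_map S (sim_shift R)\<rparr>"

lemma contracting_similarity_iff:
  "contracting_similarity S \<longleftrightarrow> similarity S \<and> sim_ratio S < 1"
  by (auto simp: contracting_similarity_def similarity_def)

lemma sim_ratio_id [simp]: "sim_ratio sim_id = 1"
  and sim_orth_id [simp]: "sim_orth sim_id = id_blinfun"
  and sim_map_id [simp]: "sim_map sim_id x = x"
  by (simp_all add: sim_id_def sim_map_def)

lemma sim_ratio_comp [simp]: "sim_ratio (sim_comp S R) = sim_ratio S * sim_ratio R"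
  and sim_orth_comp [simp]: "sim_orth (sim_comp S R) = sim_orth S o\<^sub>L sim_orth R"
  and sim_map_comp [simp]: "sim_map (sim_comp S R) x = sim_map S (sim_map R x)"
  by (simp_all add: sim_comp_def sim_map_def blinfun.add_right blinfun.scaleR_right
      scaleR_add_right)

lemma sim_comp_id [simp]: "sim_comp sim_id S = S"
  by (cases S) (auto simp: sim_comp_def sim_id_def sim_map_def intro: blinfun_eqI)

lemma sim_comp_assoc: "sim_comp (sim_comp S R) Q = sim_comp S (sim_comp R Q)"
  by (auto simp: sim_comp_def sim_map_def blinfun.add_right blinfun.scaleR_right scaleR_add_right
      intro: blinfun_eqI)

lemma image_sim_map_comp: "sim_map (sim_comp S R) ` A = sim_map S ` sim_map R ` A"
  by (simp add: image_image)

lemma similarity_id: "similarity sim_id"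
  using group.is_monoid[OF group_orthogonal_group, THEN monoid.one_closed]
  by (simp add: similarity_def orthogonal_group_def)

lemma similarity_comp:
  assumes "similarity S" "similarity R"
  shows "similarity (sim_comp S R)"
  using monoid.m_closed[OF group.is_monoid[OF group_orthogonal_group],
      of "sim_orth S" "sim_orth R"] assms
  by (simp add: similarity_def orthogonal_group_def)

lemma dist_sim_map:
  assumes "similarity S"
  shows "dist (sim_map S x) (sim_map S y) = sim_ratio S * dist x y"
proof -
  have "sim_map S x - sim_map S y = sim_ratio S *\<^sub>R blinfun_apply (sim_orth S) (x - y)"
    by (simp add: sim_map_def blinfun.diff_right scaleR_diff_right)
  then show ?thesis
    using assms by (simp add: dist_norm similarity_def orthogonal_group_def
        orthogonal_transformation)
qed

lemma inj_sim_map: "similarity S \<Longrightarrow> inj (sim_map S)"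
  by (rule injI) (metis dist_eq_0_iff dist_sim_map mult_eq_0_iff less_irrefl similarity_def)

lemma compact_sim_map_image: "compact A \<Longrightarrow> compact (sim_map S ` A)"
  unfolding sim_map_def by (intro compact_continuous_image continuous_intros)

lemma diameter_le_dist:
  fixes A :: "'a::metric_space set"
  assumes "0 \<le> d" "\<And>x y. x \<in> A \<Longrightarrow> y \<in> A \<Longrightarrow> dist x y \<le> d"
  shows "diameter A \<le> d"
  using assms by (auto simp: diameter_def intro!: cSUP_least)

text \<open>A strict contraction cannot preserve the distance of two fixed points, so there is at
  most one. \<open>separating_points\<close> has to avoid it, because a point must differ from its
  image there.\<close>

lemma finite_fixed_points:
  assumes "contracting_similarity S"
  shows "finite {x. sim_map S x = x}"
proof -
  have "x = y" if "sim_map S x = x" "sim_map S y = y" for x y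
  proof -
    have "dist x y = sim_ratio S * dist x y"
      using dist_sim_map[of S x y] assms that by (simp add: contracting_similarity_iff)
    then show ?thesis
      using assms by (auto simp: contracting_similarity_def)
  qed
  then have "\<exists>a. {x. sim_map S x = x} \<subseteq> {a}" by blast
  then show ?thesis by (meson finite.simps finite_subset)
qed

section \<open>Words over a system, recorded through their composites\<close>

primrec compositions :: "('a::euclidean_space) sim set \<Rightarrow> nat \<Rightarrow> 'a sim set" where
  "compositions \<F> 0 = {sim_id}"
| "compositions \<F> (Suc n) = (\<lambda>(S, C). sim_comp S C) ` (\<F> \<times> compositions \<F> n)"

lemma finite_compositions: "finite \<F> \<Longrightarrow> finite (compositions \<F> n)"
  by (induction n) auto

text \<open>An inequality because different words may have the same composite, and
  \<open>compositions\<close> identifies them.\<close>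

lemma card_compositions: "finite \<F> \<Longrightarrow> card (compositions \<F> n) \<le> card \<F> ^ n"
proof (induction n)
  case (Suc n)
  have "card (compositions \<F> (Suc n)) \<le> card (\<F> \<times> compositions \<F> n)"
    unfolding compositions.simps
    using Suc.prems by (intro card_image_le) (simp add: finite_compositions)
  also have "\<dots> \<le> card \<F> * card \<F> ^ n"
    using Suc by (simp add: card_cartesian_product)
  finally show ?case by simp
qed simp

lemma compositions_add:
  "C \<in> compositions \<F> m \<Longrightarrow> D \<in> compositions \<F> n \<Longrightarrow> sim_comp C D \<in> compositions \<F> (m + n)"
  by (induction m arbitrary: C) (fastforce simp: sim_comp_assoc)+


section \<open>Attractors\<close>

text \<open>The system is a set of maps here: neither the attractor nor the generated group sees the
  order or the repetitions of a list.\<close>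

locale self_similar =
  fixes \<F> :: "('a::euclidean_space) sim set" and K :: "'a set"
  assumes finite_F: "finite \<F>" and F_nonempty: "\<F> \<noteq> {}"
    and contracting: "\<And>S. S \<in> \<F> \<Longrightarrow> contracting_similarity S"
    and compact_K: "compact K" and K_nonempty: "K \<noteq> {}"
    and K_eq: "K = (\<Union>S\<in>\<F>. sim_map S ` K)"
begin

definition cylinders :: "'a sim set" where
  "cylinders = (\<Union>n. compositions \<F> n)"

definition min_ratio :: real where "min_ratio = Min (sim_ratio ` \<F>)"
definition max_ratio :: real where "max_ratio = Max (sim_ratio ` \<F>)"

lemma F_cylinder: "S \<in> \<F> \<Longrightarrow> C \<in> cylinders \<Longrightarrow> sim_comp S C \<in> cylinders"
  unfolding cylinders_def by (metis (no_types, lifting) UN_iff UNIV_I case_prod_conv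
      compositions.simps(2) imageI mem_Sigma_iff)

lemma id_cylinder: "sim_id \<in> cylinders"
  unfolding cylinders_def by (auto intro!: exI[of _ 0])

lemma comp_cylinder: "C \<in> cylinders \<Longrightarrow> D \<in> cylinders \<Longrightarrow> sim_comp C D \<in> cylinders"
  unfolding cylinders_def using compositions_add by blast

lemma cylinder_induct [consumes 1, case_names id comp]:
  assumes "C \<in> cylinders" "P sim_id"
    "\<And>S C. S \<in> \<F> \<Longrightarrow> C \<in> cylinders \<Longrightarrow> P C \<Longrightarrow> P (sim_comp S C)"
  shows "P C"
proof -
  have "C \<in> compositions \<F> n \<Longrightarrow> P C" for n
    using assms(2,3) by (induction n arbitrary: C) (auto simp: cylinders_def)
  then show ?thesis using assms(1) by (auto simp: cylinders_def)
qed

lemma min_ratio: "0 < min_ratio" "S \<in> \<F> \<Longrightarrow> min_ratio \<le> sim_ratio S"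
  using finite_F F_nonempty contracting
  by (auto simp: min_ratio_def contracting_similarity_def)

lemma max_ratio: "0 < max_ratio" "max_ratio < 1" "S \<in> \<F> \<Longrightarrow> sim_ratio S \<le> max_ratio"
  using finite_F F_nonempty contracting
  by (auto simp: max_ratio_def contracting_similarity_def Max_gr_iff)

lemma similarity_F: "S \<in> \<F> \<Longrightarrow> similarity S"
  using contracting by (simp add: contracting_similarity_iff)

lemma similarity_cylinder: "C \<in> cylinders \<Longrightarrow> similarity C"
  by (induction rule: cylinder_induct) (auto intro: similarity_id similarity_comp similarity_F)

lemma cylinder_image_subset: "C \<in> cylinders \<Longrightarrow> sim_map C ` K \<subseteq> K"
proof (induction rule: cylinder_induct)
  case (comp S C)
  then have "sim_map S ` sim_map C ` K \<subseteq> sim_map S ` K" by blast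
  also have "\<dots> \<subseteq> K" using K_eq comp by blast
  finally show ?case by (simp add: image_image)
qed simp

lemma ratio_compositions: "C \<in> compositions \<F> n \<Longrightarrow> sim_ratio C \<le> max_ratio ^ n"
proof (induction n arbitrary: C)
  case (Suc n)
  then obtain S D where "S \<in> \<F>" "D \<in> compositions \<F> n" "C = sim_comp S D" by auto
  moreover have "0 \<le> sim_ratio D"
    using similarity_cylinder[of D] \<open>D \<in> compositions \<F> n\<close>
    by (auto simp: cylinders_def similarity_def intro: less_imp_le)
  ultimately show ?case
    using Suc.IH[of D] max_ratio by (auto intro!: mult_mono)
qed simp

text \<open>Ratios at level n are at most \<open>max_ratio ^ n\<close>, so a positive lower bound on
  the ratio bounds the word length.\<close>

lemma finite_cylinders_ratio_ge:
  assumes "0 < \<eta>"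
  shows "finite {C \<in> cylinders. \<eta> \<le> sim_ratio C}"
proof -
  obtain N where N: "max_ratio ^ N < \<eta>"
    using real_arch_pow_inv[OF assms] max_ratio by blast
  have "{C \<in> cylinders. \<eta> \<le> sim_ratio C} \<subseteq> (\<Union>n<N. compositions \<F> n)"
  proof
    fix C assume "C \<in> {C \<in> cylinders. \<eta> \<le> sim_ratio C}"
    then obtain n where n: "C \<in> compositions \<F> n" "\<eta> \<le> sim_ratio C" by (auto simp: cylinders_def)
    then have "max_ratio ^ N < max_ratio ^ n"
      using N ratio_compositions[OF n(1)] by linarith
    then have "n < N" using max_ratio power_decreasing[of N n max_ratio] by (meson less_imp_le not_less)
    then show "C \<in> (\<Union>n<N. compositions \<F> n)" using n by auto
  qed
  then show ?thesis
    using finite_compositions[OF finite_F] by (meson finite_UN finite_lessThan finite_subset)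
qed

lemma compositions_cover: "K = (\<Union>C\<in>compositions \<F> n. sim_map C ` K)"
proof (induction n)
  case (Suc n)
  have "K = (\<Union>S\<in>\<F>. sim_map S ` K)" by (rule K_eq)
  also have "\<dots> = (\<Union>S\<in>\<F>. sim_map S ` (\<Union>C\<in>compositions \<F> n. sim_map C ` K))"
    using Suc by simp
  also have "\<dots> = (\<Union>C\<in>compositions \<F> (Suc n). sim_map C ` K)"
    unfolding compositions.simps by (force simp: image_iff)
  finally show ?case .
qed simp

text \<open>Follow an address of x and stop as soon as the ratio has dropped to \<delta>; the last
  letter overshoots by a factor of at least \<open>min_ratio\<close>.\<close>

lemma cylinder_of_ratio:
  assumes "x \<in> K" "0 < \<delta>" "\<delta> \<le> 1"
  obtains C where "C \<in> cylinders" "\<delta> * min_ratio \<le> sim_ratio C" "sim_ratio C \<le> \<delta>" "x \<in> sim_map C ` K"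
proof -
  \<comment> \<open>Removing the leading letter S replaces \<delta> by
    \<open>\<delta> / sim_ratio S\<close>, which may exceed 1; the induction therefore assumes only
    \<open>\<delta> * min_ratio \<le> 1\<close>. Once \<delta> is at least 1, the identity is a
    valid answer. The number n bounds the letters still needed.\<close>
  have main: "\<exists>C\<in>cylinders. \<delta> * min_ratio \<le> sim_ratio C \<and> sim_ratio C \<le> \<delta> \<and> x \<in> sim_map C ` K"
    if "x \<in> K" "0 < \<delta>" "\<delta> * min_ratio \<le> 1" "max_ratio ^ n \<le> \<delta>" for n x \<delta>
    using that
  proof (induction n arbitrary: x \<delta>)
    case 0
    then show ?case using id_cylinder by (auto intro!: bexI[of _ sim_id])
  next
    case (Suc n)
    show ?case
    proof (cases "\<delta> \<ge> 1")
      case True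
      then show ?thesis using Suc.prems id_cylinder by (auto intro!: bexI[of _ sim_id])
    next
      case False
      obtain S y where S: "S \<in> \<F>" "y \<in> K" "x = sim_map S y"
        using K_eq Suc.prems(1) by blast
      have pos: "0 < sim_ratio S" using similarity_F[OF S(1)] by (simp add: similarity_def)
      have "\<delta> * min_ratio \<le> 1 * sim_ratio S"
        using False Suc.prems min_ratio S by (intro mult_mono) auto
      then have 1: "\<delta> / sim_ratio S * min_ratio \<le> 1" using pos by (simp add: field_simps)
      have "max_ratio ^ n * sim_ratio S \<le> max_ratio ^ n * max_ratio"
        using max_ratio S by (intro mult_left_mono) auto
      then have 2: "max_ratio ^ n \<le> \<delta> / sim_ratio S"
        using pos Suc.prems(4) by (simp add: field_simps)
      obtain C where C: "C \<in> cylinders" "\<delta> / sim_ratio S * min_ratio \<le> sim_ratio C"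
        "sim_ratio C \<le> \<delta> / sim_ratio S" "y \<in> sim_map C ` K"
        using Suc.IH[OF S(2) _ 1 2] pos Suc.prems(2) by auto
      have "x \<in> sim_map (sim_comp S C) ` K" using C S by (auto simp: image_image)
      then show ?thesis
        using C S pos F_cylinder[of S C] by (auto intro!: bexI[of _ "sim_comp S C"] simp: field_simps)
    qed
  qed
  have "min_ratio \<le> 1"
    using min_ratio max_ratio F_nonempty by (meson all_not_in_conv less_imp_le order_trans)
  then have "\<delta> * min_ratio \<le> 1" using assms min_ratio by (simp add: mult_le_one)
  moreover obtain n where "max_ratio ^ n \<le> \<delta>"
    using real_arch_pow_inv[OF assms(2)] max_ratio less_imp_le by blast
  ultimately show ?thesis using main[of x \<delta> n] assms that by blast
qed

lemma dist_cylinder_le: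
  assumes "C \<in> cylinders" "x \<in> sim_map C ` K" "y \<in> sim_map C ` K"
  shows "dist x y \<le> sim_ratio C * diameter K"
proof -
  obtain a b where "a \<in> K" "b \<in> K" "x = sim_map C a" "y = sim_map C b" using assms by auto
  then show ?thesis
    using diameter_bounded_bound[OF compact_imp_bounded[OF compact_K]] similarity_cylinder[OF assms(1)]
    by (auto simp: dist_sim_map similarity_def)
qed

text \<open>In a finite K, any map of the system would carry a closest pair of distinct points to a
  strictly closer such pair. Infinitely many points are what makes it possible to dodge finitely
  many forbidden ones later.\<close>

lemma infinite_K:
  assumes "x \<in> K" "y \<in> K" "x \<noteq> y"
  shows "infinite K"
proof
  assume fin: "finite K"
  define D where "D = (\<lambda>(a, b). dist a b) ` {p \<in> K \<times> K. fst p \<noteq> snd p}"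
  have D: "finite D" "D \<noteq> {}" using fin assms by (auto simp: D_def)
  then obtain a b where ab: "a \<in> K" "b \<in> K" "a \<noteq> b" "Min D = dist a b"
    using Min_in[OF D] unfolding D_def by fastforce
  obtain S where S: "S \<in> \<F>" using F_nonempty by blast
  have "sim_map S a \<in> K" "sim_map S b \<in> K" using K_eq S ab by auto
  moreover have "sim_map S a \<noteq> sim_map S b"
    using inj_sim_map[OF similarity_F[OF S]] ab by (auto dest: injD)
  ultimately have "dist (sim_map S a) (sim_map S b) \<in> D" by (force simp: D_def)
  then have "dist a b \<le> sim_ratio S * dist a b"
    using ab(4) D(1) dist_sim_map[OF similarity_F[OF S]] by (metis Min_le)
  then show False using contracting[OF S] ab(3) by (simp add: contracting_similarity_def)
qed

end


section \<open>Bounds on the Hausdorff dimension\<close>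

text \<open>A box-counting criterion: every set of a finite cover is charged at the common size d.
  As d is positive, \<open>d powr s\<close> is 1 at exponent 0 and so agrees with the convention of
  \<open>diam_pow\<close>.\<close>

lemma hausdorff_measure_eq_0I:
  fixes A :: "'a::metric_space set"
  assumes s: "0 \<le> s"
    and cover: "\<And>e. 0 < e \<Longrightarrow> \<exists>\<U> d. finite \<U> \<and> 0 < d \<and> d \<le> e \<and> real (card \<U>) * d powr s \<le> e \<and>
      (\<forall>U\<in>\<U>. bounded U \<and> diameter U \<le> d) \<and> A \<subseteq> \<Union>\<U>"
  shows "hausdorff_measure s A = 0"
proof -
  have "hausdorff_premeasure s \<delta> A = 0" if \<delta>: "0 < \<delta>" for \<delta>
  proof -
    have "hausdorff_premeasure s \<delta> A \<le> 0 + ennreal e" if e: "0 < e" for e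
    proof -
      obtain \<U> d where U: "finite \<U>" "0 < d" "d \<le> min e \<delta>" "real (card \<U>) * d powr s \<le> min e \<delta>"
        "\<forall>U\<in>\<U>. bounded U \<and> diameter U \<le> d" "A \<subseteq> \<Union>\<U>"
        using cover[of "min e \<delta>"] e \<delta> by auto
      obtain us where us: "set us = \<U>" "length us = card \<U>"
        using finite_distinct_list[OF U(1)] by (metis distinct_card)
      \<comment> \<open>Padding by the empty set is free: its \<open>diam_pow\<close> is 0 for every
        exponent, including 0.\<close>
      define V where "V = (\<lambda>n. if n < length us then us ! n else {})"
      have "delta_cover \<delta> A V"
        unfolding delta_cover_def
      proof (intro conjI allI)
        fix n
        have "V n = {} \<or> V n \<in> \<U>" using us by (auto simp: V_def)
        then show "bounded (V n)" "diameter (V n) \<le> \<delta>" using U(3,5) \<delta> by auto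
      next
        have "\<Union>\<U> = (\<Union>n<length us. us ! n)" unfolding us(1)[symmetric] set_conv_nth by blast
        also have "\<dots> = (\<Union>n<length us. V n)" by (simp add: V_def)
        also have "\<dots> \<subseteq> (\<Union>n. V n)" by (rule UN_mono) auto
        finally show "A \<subseteq> (\<Union>n. V n)" using U(6) by (rule order_trans[rotated])
      qed
      then have "hausdorff_premeasure s \<delta> A \<le> (\<Sum>n. diam_pow s (V n))"
        unfolding hausdorff_premeasure_def by (intro INF_lower) simp
      also have "\<dots> = (\<Sum>n<length us. diam_pow s (V n))"
        by (intro suminf_finite) (auto simp: V_def diam_pow_def)
      also have "\<dots> \<le> (\<Sum>n<length us. ennreal (d powr s))"
      proof (intro sum_mono)
        fix n assume "n \<in> {..<length us}"
        then have "V n \<in> \<U>" using us by (auto simp: V_def)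
        then have "bounded (V n)" "diameter (V n) \<le> d" using U by auto
        then show "diam_pow s (V n) \<le> ennreal (d powr s)"
          using s U(2) by (auto simp: diam_pow_def intro!: ennreal_leI powr_mono2 diameter_ge_0)
      qed
      also have "\<dots> = ennreal (real (card \<U>) * d powr s)"
        by (subst sum_ennreal) (simp_all add: us)
      also have "\<dots> \<le> ennreal e" using U by (intro ennreal_leI) auto
      finally show ?thesis by simp
    qed
    then have "hausdorff_premeasure s \<delta> A \<le> 0" by (rule ennreal_le_epsilon)
    then show ?thesis by simp
  qed
  then have "hausdorff_measure s A = (SUP \<delta>\<in>{0::real<..}. 0)"
    unfolding hausdorff_measure_def by (intro SUP_cong) auto
  also have "\<dots> = 0" by (intro cSUP_const) auto
  finally show ?thesis .
qed

text \<open>Induction on the number of covering sets: a set of diameter below the gap meets only one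
  piece, so unless one set is large the cover splits into strictly smaller covers of the pieces,
  which are rescaled to covers of \<open>K\<close>.\<close>

lemma finite_cover_sum_ge:
  fixes V :: "'i \<Rightarrow> 'a::euclidean_space set"
  assumes "finite \<F>" "\<And>S. S \<in> \<F> \<Longrightarrow> similarity S" "K \<noteq> {}" "\<And>S. S \<in> \<F> \<Longrightarrow> sim_map S ` K \<subseteq> K"
    and two: "P \<in> \<F>" "Q \<in> \<F>" "P \<noteq> Q"
    and gap: "0 < c" "\<And>S R x y. S \<in> \<F> \<Longrightarrow> R \<in> \<F> \<Longrightarrow> S \<noteq> R \<Longrightarrow> x \<in> sim_map S ` K \<Longrightarrow>
      y \<in> sim_map R ` K \<Longrightarrow> c \<le> dist x y"
    and s: "0 \<le> s" "1 \<le> (\<Sum>S\<in>\<F>. sim_ratio S powr s)"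
    and "finite I" "\<And>i. i \<in> I \<Longrightarrow> bounded (V i)" "K \<subseteq> (\<Union>i\<in>I. V i)"
  shows "c powr s \<le> (\<Sum>i\<in>I. diameter (V i) powr s)"
  using assms(12-)
proof (induction "card I" arbitrary: I V rule: less_induct)
  case less
  show ?case
  proof (cases "\<exists>i\<in>I. c \<le> diameter (V i)")
    case True
    then obtain i where i: "i \<in> I" "c \<le> diameter (V i)" by blast
    have "c powr s \<le> diameter (V i) powr s" using i gap s by (intro powr_mono2) auto
    also have "\<dots> \<le> (\<Sum>i\<in>I. diameter (V i) powr s)"
      using less.prems i by (intro member_le_sum) auto
    finally show ?thesis .
  next
    case False
    define J where "J S = {i \<in> I. V i \<inter> sim_map S ` K \<noteq> {}}" for S
    have disj: "J S \<inter> J R = {}" if "S \<in> \<F>" "R \<in> \<F>" "S \<noteq> R" for S R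
    proof (rule ccontr)
      assume "J S \<inter> J R \<noteq> {}"
      then obtain i x y where i: "i \<in> I" "x \<in> V i" "x \<in> sim_map S ` K" "y \<in> V i" "y \<in> sim_map R ` K"
        unfolding J_def by blast
      then have "c \<le> dist x y" using gap(2) that by blast
      also have "\<dots> \<le> diameter (V i)" using i less.prems by (intro diameter_bounded_bound) auto
      finally show False using False i by auto
    qed
    have J_ne: "J S \<noteq> {}" if "S \<in> \<F>" for S
    proof -
      obtain x where "x \<in> K" using \<open>K \<noteq> {}\<close> by blast
      then have "sim_map S x \<in> sim_map S ` K" "sim_map S x \<in> K" using assms(4)[OF that] by auto
      then show ?thesis using less.prems(3) unfolding J_def by blast
    qed
    have piece: "sim_ratio S powr s * c powr s \<le> (\<Sum>i\<in>J S. diameter (V i) powr s)" if S: "S \<in> \<F>" for S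
    proof -
      \<comment> \<open>The second piece makes the induction descend: some covering set meets R,
        hence misses S, so \<open>J S\<close> is a proper subset of I.\<close>
      obtain R where R: "R \<in> \<F>" "R \<noteq> S" using two by metis
      have "J S \<inter> J R = {}" "J R \<noteq> {}" "J S \<subseteq> I" "J R \<subseteq> I"
        using disj[OF S R(1)] J_ne[OF R(1)] R by (auto simp: J_def)
      then have "J S \<subset> I" by blast
      then have card: "card (J S) < card I" "finite (J S)"
        using less.prems by (auto intro: psubset_card_mono finite_subset)
      have r: "0 < sim_ratio S" "similarity S" using assms(2)[OF S] by (auto simp: similarity_def)
      define W where "W i = sim_map S -` V i" for i
      have diamW: "bounded (W i)" "diameter (W i) \<le> diameter (V i) / sim_ratio S" if "i \<in> J S" for i
      proof -
        have dist: "dist x y \<le> diameter (V i) / sim_ratio S" if "x \<in> W i" "y \<in> W i" for x y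
        proof -
          have "dist (sim_map S x) (sim_map S y) \<le> diameter (V i)"
            using that less.prems \<open>i \<in> J S\<close> by (intro diameter_bounded_bound) (auto simp: W_def J_def)
          then show ?thesis using r by (simp add: dist_sim_map field_simps)
        qed
        then show "bounded (W i)" unfolding bounded_two_points by blast
        have "0 \<le> diameter (V i)"
          using less.prems that by (intro diameter_ge_0) (auto simp: J_def)
        then show "diameter (W i) \<le> diameter (V i) / sim_ratio S"
          using r dist by (intro diameter_le_dist) auto
      qed
      have "K \<subseteq> (\<Union>i\<in>J S. W i)"
      proof
        fix x assume "x \<in> K"
        then have x: "sim_map S x \<in> sim_map S ` K" "sim_map S x \<in> K" using assms(4)[OF S] by auto
        then show "x \<in> (\<Union>i\<in>J S. W i)" using less.prems(3) unfolding J_def W_def by blast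
      qed
      then have "c powr s \<le> (\<Sum>i\<in>J S. diameter (W i) powr s)"
        using less.hyps[OF card] diamW by blast
      also have "\<dots> \<le> (\<Sum>i\<in>J S. (diameter (V i) / sim_ratio S) powr s)"
        using diamW s by (intro sum_mono powr_mono2 diameter_ge_0) auto
      also have "\<dots> = (\<Sum>i\<in>J S. diameter (V i) powr s) / sim_ratio S powr s"
        using r less.prems
        by (auto simp: sum_divide_distrib J_def intro!: sum.cong powr_divide diameter_ge_0)
      finally show ?thesis using r by (simp add: field_simps)
    qed
    have "c powr s = 1 * c powr s" by simp
    also have "\<dots> \<le> (\<Sum>S\<in>\<F>. sim_ratio S powr s) * c powr s"
      using s by (intro mult_right_mono) auto
    also have "\<dots> \<le> (\<Sum>S\<in>\<F>. \<Sum>i\<in>J S. diameter (V i) powr s)"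
      unfolding sum_distrib_right by (intro sum_mono piece)
    also have "\<dots> = (\<Sum>i\<in>(\<Union>S\<in>\<F>. J S). diameter (V i) powr s)"
      using assms(1) less.prems disj by (intro sum.UNION_disjoint[symmetric]) (auto simp: J_def)
    also have "\<dots> \<le> (\<Sum>i\<in>I. diameter (V i) powr s)"
      using less.prems by (intro sum_mono2) (auto simp: J_def)
    finally show ?thesis .
  qed
qed

section \<open>From countable to finite covers: positive Hausdorff measure\<close>

lemma open_thickening_diameter_powr:
  fixes U :: "'a::metric_space set"
  assumes "bounded U" "0 < s" "0 < e"
  obtains V where "open V" "bounded V" "U \<subseteq> V" "diameter V powr s \<le> diameter U powr s + e"
proof -
  \<comment> \<open>Here s must be positive: \<open>diameter U\<close> may be 0, and
    \<open>x powr s\<close> is right continuous at 0 only then.\<close>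
  have "((\<lambda>h. (diameter U + 2 * h) powr s) \<longlongrightarrow> (diameter U + 2 * 0) powr s) (at_right 0)"
    using assms diameter_ge_0[OF assms(1)]
    by (intro tendsto_powr' tendsto_intros) (auto intro!: eventually_at_right_less[THEN eventually_mono])
  then have "eventually (\<lambda>h. (diameter U + 2 * h) powr s < diameter U powr s + e) (at_right 0)"
    using assms by (intro order_tendstoD) auto
  then obtain h where h: "0 < h" "(diameter U + 2 * h) powr s < diameter U powr s + e"
    using eventually_happens'[OF trivial_limit_at_right_real[of 0] eventually_conj[OF _ eventually_at_right_less]]
    by blast
  define V where "V = (\<Union>x\<in>U. ball x h)"
  have dist: "dist a b \<le> diameter U + 2 * h" if ab: "a \<in> V" "b \<in> V" for a b
  proof -
    obtain x y where xy: "x \<in> U" "dist x a < h" "y \<in> U" "dist y b < h" using ab by (auto simp: V_def)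
    have "dist a b \<le> dist x a + dist x y + dist y b"
      by (metis add.commute add_left_mono dist_commute dist_triangle dist_triangle2 order_trans
          add_right_mono add.assoc)
    then show ?thesis using xy diameter_bounded_bound[OF assms(1) xy(1,3)] by linarith
  qed
  show ?thesis
  proof
    show "open V" "U \<subseteq> V" using h by (auto simp: V_def)
    show bV: "bounded V" unfolding bounded_two_points using dist by blast
    have "diameter V \<le> diameter U + 2 * h"
      using dist h diameter_ge_0[OF assms(1)] by (intro diameter_le_dist) auto
    then show "diameter V powr s \<le> diameter U powr s + e"
      using h assms diameter_ge_0[OF bV] powr_mono2[of s "diameter V" "diameter U + 2 * h"] by linarith
  qed
qed

lemma disjoint_images_gap:
  assumes "finite \<F>" "\<And>S. S \<in> \<F> \<Longrightarrow> similarity S" "compact K"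
    and disj: "\<And>S R. S \<in> \<F> \<Longrightarrow> R \<in> \<F> \<Longrightarrow> S \<noteq> R \<Longrightarrow> sim_map S ` K \<inter> sim_map R ` K = {}"
  obtains c where "0 < c" "\<And>S R x y. S \<in> \<F> \<Longrightarrow> R \<in> \<F> \<Longrightarrow> S \<noteq> R \<Longrightarrow> x \<in> sim_map S ` K \<Longrightarrow>
    y \<in> sim_map R ` K \<Longrightarrow> c \<le> dist x y"
proof -
  define Z where "Z = {p \<in> \<F> \<times> \<F>. fst p \<noteq> snd p}"
  have "\<exists>c>0. \<forall>x\<in>sim_map (fst p) ` K. \<forall>y\<in>sim_map (snd p) ` K. c \<le> dist x y" if "p \<in> Z" for p
    using that disj[of "fst p" "snd p"] assms(3)
    by (intro separate_compact_closed compact_imp_closed compact_sim_map_image)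
      (simp_all add: Z_def mem_Times_iff)
  then obtain d where d: "\<And>p. p \<in> Z \<Longrightarrow> 0 < d p"
    "\<And>p x y. p \<in> Z \<Longrightarrow> x \<in> sim_map (fst p) ` K \<Longrightarrow> y \<in> sim_map (snd p) ` K \<Longrightarrow> d p \<le> dist x y"
    by metis
  \<comment> \<open>The inserted 1 keeps the minimum meaningful when there are no pairs of different
    maps.\<close>
  have fin: "finite (insert 1 (d ` Z))" using assms(1) by (simp add: Z_def)
  show ?thesis
  proof
    show "0 < Min (insert 1 (d ` Z))" using fin d(1) by (subst Min_gr_iff) auto
    fix S R x y
    assume SR: "S \<in> \<F>" "R \<in> \<F>" "S \<noteq> R" "x \<in> sim_map S ` K" "y \<in> sim_map R ` K"
    then have Z: "(S, R) \<in> Z" by (simp add: Z_def)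
    then have "Min (insert 1 (d ` Z)) \<le> d (S, R)" using fin by (intro Min_le) auto
    also have "\<dots> \<le> dist x y" using d(2)[OF Z] SR by simp
    finally show "Min (insert 1 (d ` Z)) \<le> dist x y" .
  qed
qed

text \<open>A cover with too small a sum is thickened to an open one, of which compactness keeps
  finitely many sets; these contradict \<open>finite_cover_sum_ge\<close>.\<close>

lemma hausdorff_measure_pos:
  assumes F: "finite \<F>" "\<And>S. S \<in> \<F> \<Longrightarrow> similarity S" and K: "compact K" "K \<noteq> {}"
    and sub: "\<And>S. S \<in> \<F> \<Longrightarrow> sim_map S ` K \<subseteq> K"
    and two: "P \<in> \<F>" "Q \<in> \<F>" "P \<noteq> Q"
    and disj: "\<And>S R. S \<in> \<F> \<Longrightarrow> R \<in> \<F> \<Longrightarrow> S \<noteq> R \<Longrightarrow> sim_map S ` K \<inter> sim_map R ` K = {}"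
    and s: "0 < s" "1 \<le> (\<Sum>S\<in>\<F>. sim_ratio S powr s)"
  shows "hausdorff_measure s K \<noteq> 0"
proof
  assume "hausdorff_measure s K = 0"
  then have zero: "hausdorff_premeasure s 1 K = 0"
    unfolding hausdorff_measure_def
    using SUP_upper[of 1 "{0<..}" "\<lambda>\<delta>. hausdorff_premeasure s \<delta> K"] by simp
  obtain c where c: "0 < c" "\<And>S R x y. S \<in> \<F> \<Longrightarrow> R \<in> \<F> \<Longrightarrow> S \<noteq> R \<Longrightarrow> x \<in> sim_map S ` K \<Longrightarrow>
    y \<in> sim_map R ` K \<Longrightarrow> c \<le> dist x y"
    using disjoint_images_gap[OF F K(1) disj] by metis
  \<comment> \<open>The budget against \<open>c powr s\<close>, which is 4 * \<eta>: the given cover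
    costs less than \<eta>, and thickening adds at most the geometric sum 2 * \<eta>.\<close>
  define \<eta> where "\<eta> = c powr s / 4"
  have \<eta>: "0 < \<eta>" using c by (simp add: \<eta>_def)
  then have "(INF U\<in>{U. delta_cover 1 K U}. \<Sum>n. diam_pow s (U n)) < ennreal \<eta>"
    using zero by (simp add: hausdorff_premeasure_def)
  then obtain U where U: "delta_cover 1 K U" "(\<Sum>n. diam_pow s (U n)) < ennreal \<eta>"
    by (auto simp: INF_less_iff)
  have "\<forall>n. \<exists>V. open V \<and> bounded V \<and> U n \<subseteq> V \<and>
      diameter V powr s \<le> diameter (U n) powr s + \<eta> * (1/2) ^ n"
  proof
    fix n
    have "bounded (U n)" "0 < \<eta> * (1/2) ^ n" using U(1) \<eta> by (auto simp: delta_cover_def)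
    then show "\<exists>V. open V \<and> bounded V \<and> U n \<subseteq> V \<and>
      diameter V powr s \<le> diameter (U n) powr s + \<eta> * (1/2) ^ n"
      using open_thickening_diameter_powr[of "U n" s "\<eta> * (1/2) ^ n"] s(1) by metis
  qed
  from choice[OF this] obtain V where V: "\<And>n. open (V n)" "\<And>n. bounded (V n)" "\<And>n. U n \<subseteq> V n"
    "\<And>n. diameter (V n) powr s \<le> diameter (U n) powr s + \<eta> * (1/2) ^ n"
    by blast
  have "K \<subseteq> (\<Union>n\<in>UNIV. V n)" using U(1) V(3) unfolding delta_cover_def by blast
  then obtain I where I: "finite I" "K \<subseteq> (\<Union>n\<in>I. V n)"
    using compactE_image[OF K(1), of UNIV V] V(1) by metis
  have "ennreal (\<Sum>n\<in>I. diameter (U n) powr s) = (\<Sum>n\<in>I. diam_pow s (U n))"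
  proof -
    \<comment> \<open>The empty set causes no exception: its diameter is 0, and
      \<open>0 powr s\<close> is 0.\<close>
    have "diam_pow s (U n) = ennreal (diameter (U n) powr s)" for n
      using s by (simp add: diam_pow_def diameter_def)
    then show ?thesis by (simp add: sum_ennreal)
  qed
  also have "\<dots> \<le> (\<Sum>n. diam_pow s (U n))"
    by (intro sum_le_suminf I) auto
  also have "\<dots> < ennreal \<eta>" by (rule U)
  finally have 1: "(\<Sum>n\<in>I. diameter (U n) powr s) < \<eta>"
    using \<eta> by (simp add: ennreal_less_iff sum_nonneg)
  have "(\<Sum>n\<in>I. \<eta> * (1/2) ^ n) \<le> (\<Sum>n. \<eta> * (1/2) ^ n)"
    using \<eta> I by (intro sum_le_suminf summable_mult summable_geometric) auto
  also have "\<dots> = 2 * \<eta>" using suminf_geometric[of "1/2::real"]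
    by (subst suminf_mult) (auto intro: summable_geometric)
  finally have 2: "(\<Sum>n\<in>I. \<eta> * (1/2) ^ n) \<le> 2 * \<eta>" .
  have "c powr s \<le> (\<Sum>n\<in>I. diameter (V n) powr s)"
    using s V(2) I
    by (intro finite_cover_sum_ge[OF F K(2) sub two c]) auto
  also have "\<dots> \<le> (\<Sum>n\<in>I. diameter (U n) powr s + \<eta> * (1/2) ^ n)"
    by (intro sum_mono V)
  also have "\<dots> < 3 * \<eta>" using 1 2 by (simp add: sum.distrib)
  finally show False using c by (simp add: \<eta>_def)
qed

lemma hausdorff_dim_nonneg: "0 \<le> hausdorff_dim A"
  unfolding hausdorff_dim_def by (intro INF_greatest) auto

lemma hausdorff_dim_le: "0 \<le> s \<Longrightarrow> hausdorff_measure s A = 0 \<Longrightarrow> hausdorff_dim A \<le> ereal s"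
  unfolding hausdorff_dim_def by (intro INF_lower) auto

text \<open>Every cover of a nonempty set has a nonempty member, of weight 1 at exponent 0. This
  settles the one exponent that \<open>hausdorff_measure_pos\<close> leaves out.\<close>

lemma hausdorff_measure_0_pos:
  assumes "A \<noteq> {}"
  shows "hausdorff_measure 0 A \<noteq> 0"
proof
  assume "hausdorff_measure 0 A = 0"
  then have "hausdorff_premeasure 0 1 A = 0"
    unfolding hausdorff_measure_def
    using SUP_upper[of 1 "{0<..}" "\<lambda>\<delta>. hausdorff_premeasure 0 \<delta> A"] by simp
  moreover have "1 \<le> hausdorff_premeasure 0 1 A"
    unfolding hausdorff_premeasure_def
  proof (intro INF_greatest)
    fix U :: "nat \<Rightarrow> 'a set" assume "U \<in> {U. delta_cover 1 A U}"
    then obtain n where "U n \<noteq> {}" using assms unfolding delta_cover_def by blast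
    then have "1 = (\<Sum>n\<in>{n}. diam_pow 0 (U n))" by (simp add: diam_pow_def)
    also have "\<dots> \<le> (\<Sum>n. diam_pow 0 (U n))" by (intro sum_le_suminf) auto
    finally show "1 \<le> (\<Sum>n. diam_pow 0 (U n))" .
  qed
  ultimately show False by simp
qed

text \<open>Ratios are below 1, so lowering the exponent from t to s only increases the sum; hence
  the measure cannot vanish at any s < t.\<close>

lemma hausdorff_dim_ge:
  assumes F: "finite \<F>" "\<And>S. S \<in> \<F> \<Longrightarrow> contracting_similarity S" and K: "compact K" "K \<noteq> {}"
    and sub: "\<And>S. S \<in> \<F> \<Longrightarrow> sim_map S ` K \<subseteq> K"
    and two: "P \<in> \<F>" "Q \<in> \<F>" "P \<noteq> Q"
    and disj: "\<And>S R. S \<in> \<F> \<Longrightarrow> R \<in> \<F> \<Longrightarrow> S \<noteq> R \<Longrightarrow> sim_map S ` K \<inter> sim_map R ` K = {}"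
    and t: "1 \<le> (\<Sum>S\<in>\<F>. sim_ratio S powr t)"
  shows "ereal t \<le> hausdorff_dim K"
  unfolding hausdorff_dim_def
proof (intro INF_greatest)
  fix s assume "s \<in> {s. 0 \<le> s \<and> hausdorff_measure s K = 0}"
  then have s: "0 \<le> s" "hausdorff_measure s K = 0" by auto
  show "ereal t \<le> ereal s"
  proof (rule ccontr)
    assume "\<not> ?thesis"
    then have "s < t" by simp
    note t
    also have "(\<Sum>S\<in>\<F>. sim_ratio S powr t) \<le> (\<Sum>S\<in>\<F>. sim_ratio S powr s)"
      using F(2) \<open>s < t\<close> by (intro sum_mono powr_mono') (auto simp: contracting_similarity_def less_imp_le)
    finally have "1 \<le> (\<Sum>S\<in>\<F>. sim_ratio S powr s)" .
    moreover have "s \<noteq> 0" using hausdorff_measure_0_pos[OF K(2)] s by auto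
    ultimately show False
      using hausdorff_measure_pos[OF F(1) _ K sub two disj, of s] F(2) s
      by (auto simp: contracting_similarity_iff)
  qed
qed

section \<open>Attractors inside a set that the maps send into itself\<close>

lemma attractor_exists:
  assumes F: "finite \<F>" "\<F> \<noteq> {}" "\<And>S. S \<in> \<F> \<Longrightarrow> similarity S" and K: "compact K" "K \<noteq> {}"
    and sub: "\<And>S. S \<in> \<F> \<Longrightarrow> sim_map S ` K \<subseteq> K"
  obtains L where "compact L" "L \<noteq> {}" "L \<subseteq> K" "L = (\<Union>S\<in>\<F>. sim_map S ` L)"
proof -
  \<comment> \<open>Instead of a fixed point theorem on the space of compact sets, L is the
    intersection of the iterates of H on K. They decrease because K is mapped into itself, and
    \<open>L \<subseteq> K\<close> comes for free.\<close>
  define H where "H A = (\<Union>S\<in>\<F>. sim_map S ` A)" for A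
  define A where "A n = (H ^^ n) K" for n
  have A_Suc: "A (Suc n) = H (A n)" for n by (simp add: A_def)
  have A_dec_Suc: "A (Suc n) \<subseteq> A n" for n
  proof (induction n)
    case 0
    then show ?case using sub by (auto simp: A_def H_def)
  next
    case (Suc n)
    have "H (A (Suc n)) \<subseteq> H (A n)" using Suc unfolding H_def by blast
    then show ?case by (simp add: A_Suc)
  qed
  have dec: "A n \<subseteq> A m" if "m \<le> n" for m n
    using lift_Suc_antimono_le[of A, OF A_dec_Suc that] .
  have cpt: "compact (A n)" for n
  proof (induction n)
    case (Suc n)
    then show ?case unfolding A_Suc H_def using F by (intro compact_UN compact_sim_map_image) auto
  qed (simp add: A_def K)
  have ne: "A n \<noteq> {}" for n
  proof (induction n)
    case (Suc n)
    then show ?case unfolding A_Suc H_def using F by auto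
  qed (simp add: A_def K)
  define L where "L = (\<Inter>n. A n)"
  have LA: "L \<subseteq> A n" for n by (auto simp: L_def)
  show ?thesis
  proof
    show "compact L" unfolding L_def using cpt
      by (intro compact_Inter) auto
    show "L \<noteq> {}" unfolding L_def by (rule compact_nest[OF cpt ne dec])
    show "L \<subseteq> K" using LA[of 0] by (simp add: A_def)
    show "L = (\<Union>S\<in>\<F>. sim_map S ` L)"
    proof
      have "H L \<subseteq> A n" for n
      proof -
        have "H L \<subseteq> H (A n)" using LA[of n] unfolding H_def by blast
        then show ?thesis using A_dec_Suc[of n] by (simp add: A_Suc)
      qed
      then show "(\<Union>S\<in>\<F>. sim_map S ` L) \<subseteq> L" unfolding L_def H_def by blast
    next
      show "L \<subseteq> (\<Union>S\<in>\<F>. sim_map S ` L)"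
      proof
        fix x assume x: "x \<in> L"
        have "\<forall>n. \<exists>S\<in>\<F>. x \<in> sim_map S ` A n"
          using LA[of "Suc _"] x unfolding A_Suc H_def by blast
        then obtain f where f: "\<And>n. f n \<in> \<F>" "\<And>n. x \<in> sim_map (f n) ` A n" by metis
        \<comment> \<open>Pigeonhole: one map S serves infinitely many levels, hence all levels, as
          the \<open>A n\<close> decrease. Injectivity of S then lets its image commute with the
          intersection.\<close>
        have "finite (range f)" using f(1) F(1) by (meson finite_subset image_subsetI)
        then obtain S where S: "S \<in> range f" "infinite (f -` {S})"
          using inf_img_fin_dom'[of f UNIV] by auto
        then have SF: "S \<in> \<F>" using f by auto
        have "x \<in> sim_map S ` A n" for n
        proof -
          obtain k where "n < k" "f k = S"
            using S(2) unfolding infinite_nat_iff_unbounded by auto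
          then show ?thesis using f(2)[of k] dec[of n k] by auto
        qed
        then have "x \<in> (\<Inter>n. sim_map S ` A n)" by blast
        also have "\<dots> = sim_map S ` L"
          unfolding L_def using image_INT[OF inj_sim_map[OF F(3)[OF SF]], of UNIV A] by simp
        finally show "x \<in> (\<Union>S\<in>\<F>. sim_map S ` L)" using SF by blast
      qed
    qed
  qed
qed


section \<open>Disjoint cylinders\<close>

lemma maximal_disjoint_subfamily:
  assumes "finite A" "\<And>a. a \<in> A \<Longrightarrow> f a \<noteq> {}"
  obtains B where "B \<subseteq> A" "\<And>a b. a \<in> B \<Longrightarrow> b \<in> B \<Longrightarrow> a \<noteq> b \<Longrightarrow> f a \<inter> f b = {}"
    "\<And>a. a \<in> A \<Longrightarrow> \<exists>b\<in>B. f a \<inter> f b \<noteq> {}"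
proof -
  have "\<exists>B\<subseteq>A. (\<forall>a\<in>B. \<forall>b\<in>B. a \<noteq> b \<longrightarrow> f a \<inter> f b = {}) \<and> (\<forall>a\<in>A. \<exists>b\<in>B. f a \<inter> f b \<noteq> {})"
    using assms
  proof (induction A rule: finite_induct)
    case (insert x A)
    then obtain B where B: "B \<subseteq> A" "\<forall>a\<in>B. \<forall>b\<in>B. a \<noteq> b \<longrightarrow> f a \<inter> f b = {}"
      "\<forall>a\<in>A. \<exists>b\<in>B. f a \<inter> f b \<noteq> {}" by auto
    show ?case
    proof (cases "\<exists>b\<in>B. f x \<inter> f b \<noteq> {}")
      case True
      then show ?thesis using B by (intro exI[of _ B]) auto
    next
      case False
      \<comment> \<open>Nonemptiness lets a selected element be its own witness in the maximality
        clause.\<close>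
      moreover have "f x \<noteq> {}" using insert.prems by simp
      ultimately show ?thesis using B by (intro exI[of _ "insert x B"]) (auto simp: Int_commute)
    qed
  qed auto
  then show ?thesis using that by metis
qed

text \<open>The points are chosen one map at a time, each avoiding a finite set. The Boolean index
  tells a point (\<open>True\<close>) from its image (\<open>False\<close>), so that one injectivity
  statement expresses all the required inequalities.\<close>

lemma separating_points:
  assumes "infinite K" "finite \<F>" "\<And>S. S \<in> \<F> \<Longrightarrow> contracting_similarity S"
  shows "\<exists>p. (\<forall>S\<in>\<F>. p S \<in> K) \<and>
    inj_on (\<lambda>(S, b). if b then p S else sim_map S (p S)) (\<F> \<times> UNIV)"
  using assms(2,3)
proof (induction \<F> rule: finite_induct)
  case (insert S \<F>)
  then obtain p where p: "\<forall>S\<in>\<F>. p S \<in> K"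
    "inj_on (\<lambda>(S, b). if b then p S else sim_map S (p S)) (\<F> \<times> UNIV)" by auto
  define f where "f = (\<lambda>(S, b). if b then p S else sim_map S (p S))"
  define B where "B = f ` (\<F> \<times> UNIV)"
  have S: "contracting_similarity S" "similarity S"
    using insert.prems by (auto simp: contracting_similarity_iff)
  have B: "finite B" using insert.hyps by (simp add: B_def)
  \<comment> \<open>The three sets are the three possible collisions: q with an old point, the image
    of q with an old point, and q with its own image. The second is finite because S is
    injective.\<close>
  have "finite (B \<union> sim_map S -` B \<union> {x. sim_map S x = x})"
    using B finite_vimageI[OF B inj_sim_map[OF S(2)]] finite_fixed_points[OF S(1)] by simp
  then have "\<not> K \<subseteq> B \<union> sim_map S -` B \<union> {x. sim_map S x = x}"
    using assms(1) finite_subset by blast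
  then obtain q where q: "q \<in> K" "q \<notin> B" "sim_map S q \<notin> B" "sim_map S q \<noteq> q" by blast
  define g where "g = (\<lambda>(R, b). if b then (p(S := q)) R else sim_map R ((p(S := q)) R))"
  have gf: "g x = f x" if "x \<in> \<F> \<times> UNIV" for x
    using that insert.hyps by (auto simp: g_def f_def)
  have "inj_on g (\<F> \<times> UNIV)"
    using p(2) inj_on_cong[of "\<F> \<times> UNIV" g f] gf by (simp add: f_def)
  moreover have "inj_on g ({S} \<times> UNIV)"
    using q by (auto simp: inj_on_def g_def)
  moreover have "g ` (\<F> \<times> UNIV) = B" unfolding B_def using gf by (intro image_cong) auto
  moreover have "g ` ({S} \<times> UNIV) \<inter> B = {}" using q by (auto simp: g_def split: if_splits)
  ultimately have "inj_on g ({S} \<times> UNIV \<union> \<F> \<times> UNIV)"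
    unfolding inj_on_Un by blast
  moreover have "{S} \<times> UNIV \<union> \<F> \<times> UNIV = insert S \<F> \<times> (UNIV :: bool set)" by auto
  ultimately have "inj_on g (insert S \<F> \<times> UNIV)" by simp
  then show ?case using p(1) q(1) unfolding g_def by (intro exI[of _ "p(S := q)"]) auto
qed auto

section \<open>Dimension of K and disjoint families of cylinders\<close>

context self_similar
begin

lemma diameter_K_nonneg: "0 \<le> diameter K"
  by (rule diameter_ge_0[OF compact_imp_bounded[OF compact_K]])

lemma bounded_cylinder: "C \<in> cylinders \<Longrightarrow> bounded (sim_map C ` K)"
  using dist_cylinder_le unfolding bounded_two_points by blast

text \<open>Needed so that \<epsilon> can be subtracted from a real number. The crude cover by all
  cylinders of level n suffices: for k large, \<open>max_ratio ^ k\<close> beats the number of maps,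
  and the sums at exponent k decay geometrically in n.\<close>

lemma hausdorff_dim_K_less_top: "hausdorff_dim K < \<infinity>"
proof -
  define N where "N = card \<F>"
  have N: "0 < N" using finite_F F_nonempty by (simp add: N_def card_gt_0_iff)
  obtain k where k: "max_ratio ^ k < 1 / real N"
    using real_arch_pow_inv[of "1 / real N" max_ratio] max_ratio N by auto
  define q where "q = real N * max_ratio ^ k"
  have q: "0 \<le> q" "q < 1" using k N max_ratio by (auto simp: q_def field_simps)
  define D where "D = diameter K + 1"
  have D: "0 < D" using diameter_K_nonneg by (simp add: D_def)
  have "hausdorff_measure (real k) K = 0"
  proof (rule hausdorff_measure_eq_0I)
    fix e :: real assume e: "0 < e"
    have "(\<lambda>n. max_ratio ^ n * D) \<longlonglongrightarrow> 0 * D" "(\<lambda>n. q ^ n * D ^ k) \<longlonglongrightarrow> 0 * D ^ k"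
      using max_ratio q by (intro tendsto_intros LIMSEQ_realpow_zero; simp)+
    then have "eventually (\<lambda>n. max_ratio ^ n * D < e) sequentially"
      "eventually (\<lambda>n. q ^ n * D ^ k < e) sequentially"
      using e by (auto dest: order_tendstoD(2))
    then obtain n where n: "max_ratio ^ n * D < e" "q ^ n * D ^ k < e"
      using eventually_happens'[OF sequentially_bot eventually_conj] by blast
    define d where "d = max_ratio ^ n * D"
    have d: "0 < d" using max_ratio D by (simp add: d_def)
    define \<U> where "\<U> = (\<lambda>C. sim_map C ` K) ` compositions \<F> n"
    have "card \<U> \<le> N ^ n"
      unfolding \<U>_def N_def
      using card_image_le[OF finite_compositions[OF finite_F]] card_compositions[OF finite_F]
        order_trans by blast
    then have "real (card \<U>) * d powr real k \<le> real (N ^ n) * d ^ k"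
      using d by (intro mult_mono) (auto simp: powr_realpow)
    also have "\<dots> = q ^ n * D ^ k"
      by (simp add: d_def q_def power_mult_distrib mult.assoc flip: power_mult)
        (simp add: mult.commute)
    finally have "real (card \<U>) * d powr real k \<le> e" using n by linarith
    moreover have "bounded U \<and> diameter U \<le> d" if U: "U \<in> \<U>" for U
    proof -
      obtain C where C: "C \<in> compositions \<F> n" "U = sim_map C ` K" using U unfolding \<U>_def by blast
      then have cyl: "C \<in> cylinders" by (auto simp: cylinders_def)
      have "sim_ratio C * diameter K \<le> d"
        unfolding d_def D_def using ratio_compositions[OF C(1)] diameter_K_nonneg max_ratio
        by (intro mult_mono) auto
      then have "dist x y \<le> d" if "x \<in> U" "y \<in> U" for x y
        using dist_cylinder_le[OF cyl, of x y] that C by simp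
      then show ?thesis using d bounded_cylinder[OF cyl] C by (auto intro: diameter_le_dist)
    qed
    moreover have "K \<subseteq> \<Union>\<U>" using compositions_cover[of n] by (simp add: \<U>_def)
    moreover have "finite \<U>" using finite_compositions[OF finite_F] by (simp add: \<U>_def)
    ultimately show "\<exists>\<U> d. finite \<U> \<and> 0 < d \<and> d \<le> e \<and> real (card \<U>) * d powr real k \<le> e \<and>
      (\<forall>U\<in>\<U>. bounded U \<and> diameter U \<le> d) \<and> K \<subseteq> \<Union>\<U>"
      using d n by (intro exI[of _ \<U>] exI[of _ d]) (auto simp: d_def)
  qed simp
  then have "hausdorff_dim K \<le> ereal (real k)" by (intro hausdorff_dim_le) auto
  then show ?thesis using less_ereal.simps(4) order_le_less_trans by blast
qed

text \<open>A maximal disjoint family of cylinders of size about \<open>\<delta>\<close> yields, after enlarging each of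
  its members by a constant factor, a cover of \<open>K\<close>; were the sums bounded for all \<open>\<delta>\<close>, the
  dimension of \<open>K\<close> would be at most \<open>t\<close>.\<close>

lemma disjoint_cylinders_sum_ge:
  assumes t: "ereal t < hausdorff_dim K" "0 \<le> t"
  shows "\<exists>\<W>. finite \<W> \<and> \<W> \<subseteq> cylinders \<and> (\<forall>C\<in>\<W>. sim_ratio C < 1) \<and>
    (\<forall>C\<in>\<W>. \<forall>D\<in>\<W>. C \<noteq> D \<longrightarrow> sim_map C ` K \<inter> sim_map D ` K = {}) \<and>
    M \<le> (\<Sum>C\<in>\<W>. sim_ratio C powr t)"
proof (rule ccontr)
  assume "\<not> ?thesis"
  then have small: "(\<Sum>C\<in>\<W>. sim_ratio C powr t) < M"
    if "finite \<W>" "\<W> \<subseteq> cylinders" "\<And>C. C \<in> \<W> \<Longrightarrow> sim_ratio C < 1"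
      "\<And>C D. C \<in> \<W> \<Longrightarrow> D \<in> \<W> \<Longrightarrow> C \<noteq> D \<Longrightarrow> sim_map C ` K \<inter> sim_map D ` K = {}" for \<W>
    using that by (meson not_le)
  obtain s where s: "ereal t < ereal s" "ereal s < hausdorff_dim K" using ereal_dense2[OF t(1)] by blast
  define D where "D = diameter K"
  have D: "0 \<le> D" using diameter_K_nonneg by (simp add: D_def)
  \<comment> \<open>The covering balls below have radius 2 * \<delta> * D, hence diameter at most 4
    * \<delta> * D; adding 1 keeps B positive when D is 0.\<close>
  define B where "B = 4 * (D + 1)"
  have B: "0 < B" using D by (simp add: B_def)
  obtain p where p: "p \<in> K" using K_nonempty by blast
  have "hausdorff_measure s K = 0"
  proof (rule hausdorff_measure_eq_0I)
    show "0 \<le> s" using t s by simp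
    fix e :: real assume e: "0 < e"
    \<comment> \<open>The two quantities are the mesh of the cover and the bound on its sum at
      exponent s. The strict gap between t and s makes the second one vanish as \<delta> tends to
      0.\<close>
    have "((\<lambda>\<delta>. B * \<delta>) \<longlongrightarrow> B * 0) (at_right 0)"
      "((\<lambda>\<delta>. M / min_ratio powr t * B powr s * \<delta> powr (s - t)) \<longlongrightarrow>
        M / min_ratio powr t * B powr s * 0 powr (s - t)) (at_right 0)"
      using s by (intro tendsto_intros tendsto_powr';
          auto intro!: eventually_at_right_less[THEN eventually_mono])+
    then have "eventually (\<lambda>\<delta>. B * \<delta> < e) (at_right 0)"
      "eventually (\<lambda>\<delta>. M / min_ratio powr t * B powr s * \<delta> powr (s - t) < e) (at_right 0)"
      using e by (auto dest: order_tendstoD(2))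
    moreover have "eventually (\<lambda>\<delta>::real. 0 < \<delta> \<and> \<delta> < 1) (at_right 0)"
      using eventually_at_right_less[of "0::real"] order_tendstoD(2)[OF tendsto_ident_at, of "0::real" 1]
      by (auto intro: eventually_conj)
    ultimately have "eventually (\<lambda>\<delta>. B * \<delta> < e \<and>
        M / min_ratio powr t * B powr s * \<delta> powr (s - t) < e \<and> 0 < \<delta> \<and> \<delta> < 1) (at_right 0)"
      by (intro eventually_conj) (auto elim: eventually_mono)
    then obtain \<delta> where \<delta>: "B * \<delta> < e" "M / min_ratio powr t * B powr s * \<delta> powr (s - t) < e"
      "0 < \<delta>" "\<delta> < 1"
      using eventually_happens'[OF trivial_limit_at_right_real] by blast
    define A where "A = {C \<in> cylinders. \<delta> * min_ratio \<le> sim_ratio C \<and> sim_ratio C \<le> \<delta>}"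
    have "finite A"
      unfolding A_def using finite_cylinders_ratio_ge[of "\<delta> * min_ratio"] \<delta> min_ratio
      by (rule_tac finite_subset[rotated]) auto
    then obtain \<W> where W: "\<W> \<subseteq> A"
      "\<And>C D. C \<in> \<W> \<Longrightarrow> D \<in> \<W> \<Longrightarrow> C \<noteq> D \<Longrightarrow> sim_map C ` K \<inter> sim_map D ` K = {}"
      "\<And>C. C \<in> A \<Longrightarrow> \<exists>D\<in>\<W>. sim_map C ` K \<inter> sim_map D ` K \<noteq> {}"
      using maximal_disjoint_subfamily[of A "\<lambda>C. sim_map C ` K"] K_nonempty
      by (metis (no_types, lifting) image_is_empty)
    have finW: "finite \<W>" using W(1) \<open>finite A\<close> finite_subset by blast
    have Wcyl: "\<W> \<subseteq> cylinders" using W(1) by (auto simp: A_def)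
    \<comment> \<open>Each member contributes at least \<open>(\<delta> * min_ratio) powr t\<close>,
      so the bound M on the sum becomes a bound on the number of members.\<close>
    have "real (card \<W>) * (\<delta> * min_ratio) powr t = (\<Sum>C\<in>\<W>. (\<delta> * min_ratio) powr t)" by simp
    also have "\<dots> \<le> (\<Sum>C\<in>\<W>. sim_ratio C powr t)"
      using W(1) \<delta> min_ratio t by (intro sum_mono powr_mono2) (auto simp: A_def)
    also have "\<dots> < M"
      using finW Wcyl W \<delta> by (intro small) (auto simp: A_def)
    finally have card: "real (card \<W>) * (\<delta> powr t * min_ratio powr t) \<le> M"
      using \<delta> min_ratio by (simp add: powr_mult)
    define d where "d = B * \<delta>"
    define \<U> where "\<U> = (\<lambda>C. cball (sim_map C p) (2 * \<delta> * D)) ` \<W>"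
    have "real (card \<U>) * d powr s \<le> real (card \<W>) * d powr s"
      unfolding \<U>_def using card_image_le[OF finW] by (intro mult_right_mono) auto
    also have "\<dots> \<le> M / (\<delta> powr t * min_ratio powr t) * d powr s"
      using card \<delta> min_ratio by (intro mult_right_mono) (simp_all add: field_simps)
    also have "\<dots> = M / min_ratio powr t * B powr s * \<delta> powr (s - t)"
      using \<delta> B by (simp add: d_def powr_mult powr_diff mult_ac)
    finally have "real (card \<U>) * d powr s \<le> e" using \<delta> by linarith
    moreover have "bounded U \<and> diameter U \<le> d" if U: "U \<in> \<U>" for U
    proof -
      obtain c where c: "U = cball c (2 * \<delta> * D)" using U by (auto simp: \<U>_def)
      have "dist x y \<le> 4 * \<delta> * D" if "x \<in> U" "y \<in> U" for x y
        using that dist_triangle3[of x y c] by (auto simp: c)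
      moreover have "4 * \<delta> * D \<le> d" using \<delta> D by (simp add: d_def B_def algebra_simps)
      ultimately have "dist x y \<le> d" if "x \<in> U" "y \<in> U" for x y
        using that by (meson order_trans)
      then have "diameter U \<le> d" using \<delta> B by (intro diameter_le_dist) (auto simp: d_def)
      then show ?thesis by (simp add: c)
    qed
    moreover have "K \<subseteq> \<Union>\<U>"
    proof
      fix x assume x: "x \<in> K"
      obtain C where C: "C \<in> A" "x \<in> sim_map C ` K"
        by (rule cylinder_of_ratio[OF x \<delta>(3) less_imp_le[OF \<delta>(4)]]) (simp add: A_def that)
      \<comment> \<open>By maximality the cylinder of x meets a selected one; two cylinders of
        diameter at most \<delta> * D are crossed on the way to x, whence the radius 2 * \<delta> *
        D.\<close>
      obtain E z where E: "E \<in> \<W>" "z \<in> sim_map C ` K" "z \<in> sim_map E ` K" using W(3)[OF C(1)] by blast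
      have le: "sim_ratio X * D \<le> \<delta> * D" if "X \<in> A" for X
        using that D by (intro mult_right_mono) (auto simp: A_def)
      have "dist (sim_map E p) z \<le> \<delta> * D"
        using dist_cylinder_le[of E "sim_map E p" z] E p le[of E] W(1) Wcyl by (fastforce simp: D_def)
      moreover have "dist z x \<le> \<delta> * D"
        using dist_cylinder_le[of C z x] C E le[of C] by (fastforce simp: D_def A_def)
      ultimately have "dist (sim_map E p) x \<le> 2 * \<delta> * D"
        using dist_triangle[of "sim_map E p" x z] by linarith
      then show "x \<in> \<Union>\<U>" using E(1) by (auto simp: \<U>_def)
    qed
    ultimately show "\<exists>\<U> d. finite \<U> \<and> 0 < d \<and> d \<le> e \<and> real (card \<U>) * d powr s \<le> e \<and>
      (\<forall>U\<in>\<U>. bounded U \<and> diameter U \<le> d) \<and> K \<subseteq> \<Union>\<U>"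
      using \<delta> B finW by (intro exI[of _ \<U>] exI[of _ d]) (auto simp: d_def \<U>_def)
  qed
  then have "hausdorff_dim K \<le> ereal s" using t s by (intro hausdorff_dim_le) auto
  then show False using s by simp
qed

section \<open>Small cylinders around prescribed points\<close>

lemma separated_points_disjoint_cylinders:
  assumes "finite Z"
  obtains \<delta> where "0 < \<delta>" "\<delta> < 1"
    "\<And>z w C D. z \<in> Z \<Longrightarrow> w \<in> Z \<Longrightarrow> z \<noteq> w \<Longrightarrow> C \<in> cylinders \<Longrightarrow> D \<in> cylinders \<Longrightarrow> sim_ratio C \<le> \<delta> \<Longrightarrow>
      sim_ratio D \<le> \<delta> \<Longrightarrow> z \<in> sim_map C ` K \<Longrightarrow> w \<in> sim_map D ` K \<Longrightarrow> sim_map C ` K \<inter> sim_map D ` K = {}"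
proof -
  define R where "R = (\<lambda>(z, w). dist z w) ` {p \<in> Z \<times> Z. fst p \<noteq> snd p}"
  define \<eta> where "\<eta> = Min (insert 1 R)"
  have fin: "finite (insert 1 R)" using assms by (simp add: R_def)
  have \<eta>: "0 < \<eta>" unfolding \<eta>_def using fin by (subst Min_gr_iff) (auto simp: R_def)
  have sep: "\<eta> \<le> dist z w" if "z \<in> Z" "w \<in> Z" "z \<noteq> w" for z w
    unfolding \<eta>_def using that fin by (intro Min_le) (force simp: R_def)+
  \<comment> \<open>Intersecting cylinders of ratio at most \<delta> would put their points within 2
    * \<delta> * \<open>diameter K\<close>; the extra 1 in the denominator makes this strictly less
    than \<eta>. The bound 1/2 gives \<delta> < 1.\<close>
  define \<delta> where "\<delta> = min (1/2) (\<eta> / (2 * (diameter K + 1)))"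
  have D: "0 \<le> diameter K" by (rule diameter_K_nonneg)
  have \<delta>: "0 < \<delta>" using \<eta> D by (simp add: \<delta>_def)
  have "\<delta> \<le> \<eta> / (2 * (diameter K + 1))" unfolding \<delta>_def by (rule min.cobounded2)
  then have "\<delta> * (2 * (diameter K + 1)) \<le> \<eta>" using D by (simp add: field_simps)
  then have \<delta>_lt: "2 * (\<delta> * diameter K) < \<eta>" using \<delta> by (simp add: algebra_simps)
  show ?thesis
  proof
    show "0 < \<delta>" "\<delta> < 1" using \<delta> by (auto simp: \<delta>_def)
    fix z w C D
    assume zw: "z \<in> Z" "w \<in> Z" "z \<noteq> w" and cyl: "C \<in> cylinders" "D \<in> cylinders"
      and le: "sim_ratio C \<le> \<delta>" "sim_ratio D \<le> \<delta>"
      and mem: "z \<in> sim_map C ` K" "w \<in> sim_map D ` K"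
    show "sim_map C ` K \<inter> sim_map D ` K = {}"
    proof (rule ccontr)
      assume "sim_map C ` K \<inter> sim_map D ` K \<noteq> {}"
      then obtain x where x: "x \<in> sim_map C ` K" "x \<in> sim_map D ` K" by blast
      have "dist z x \<le> \<delta> * diameter K"
        using dist_cylinder_le[OF cyl(1) mem(1) x(1)] mult_right_mono[OF le(1) D] by linarith
      moreover have "dist x w \<le> \<delta> * diameter K"
        using dist_cylinder_le[OF cyl(2) x(2) mem(2)] mult_right_mono[OF le(2) D] by linarith
      ultimately show False using dist_triangle[of z w x] sep[OF zw] \<delta>_lt by linarith
    qed
  qed
qed

text \<open>One point q beyond the chosen points and their images reserves room for U. The clause
  \<open>sim_comp S C \<noteq> C\<close> later supplies the two different maps that the lower bound
  on the dimension asks for.\<close>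

lemma generating_disjoint_cylinders:
  assumes "infinite K"
  obtains \<G> U where "finite \<G>" "\<G> \<subseteq> cylinders" "\<And>C. C \<in> \<G> \<Longrightarrow> sim_ratio C < 1"
    "\<And>C D. C \<in> \<G> \<Longrightarrow> D \<in> \<G> \<Longrightarrow> C \<noteq> D \<Longrightarrow> sim_map C ` K \<inter> sim_map D ` K = {}"
    "U \<in> cylinders" "sim_ratio U < 1" "\<And>C. C \<in> \<G> \<Longrightarrow> sim_map C ` K \<inter> sim_map U ` K = {}"
    "\<And>S. S \<in> \<F> \<Longrightarrow> \<exists>C\<in>\<G>. sim_comp S C \<in> \<G> \<and> sim_comp S C \<noteq> C"
proof -
  obtain p where p: "\<forall>S\<in>\<F>. p S \<in> K"
    "inj_on (\<lambda>(S, b). if b then p S else sim_map S (p S)) (\<F> \<times> UNIV)"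
    using separating_points[OF assms finite_F contracting] by blast
  define pt where "pt = (\<lambda>(S, b). if b then p S else sim_map S (p S))"
  have inj: "inj_on pt (\<F> \<times> UNIV)" using p(2) by (simp add: pt_def)
  have fin: "finite (pt ` (\<F> \<times> UNIV))" using finite_F by simp
  then have "\<not> K \<subseteq> pt ` (\<F> \<times> UNIV)" using assms finite_subset by blast
  then obtain q where q: "q \<in> K" "q \<notin> pt ` (\<F> \<times> UNIV)" by blast
  obtain \<delta> where \<delta>: "0 < \<delta>" "\<delta> < 1"
    "\<And>z w C D. z \<in> insert q (pt ` (\<F> \<times> UNIV)) \<Longrightarrow> w \<in> insert q (pt ` (\<F> \<times> UNIV)) \<Longrightarrow> z \<noteq> w \<Longrightarrow>
      C \<in> cylinders \<Longrightarrow> D \<in> cylinders \<Longrightarrow> sim_ratio C \<le> \<delta> \<Longrightarrow> sim_ratio D \<le> \<delta> \<Longrightarrow>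
      z \<in> sim_map C ` K \<Longrightarrow> w \<in> sim_map D ` K \<Longrightarrow> sim_map C ` K \<inter> sim_map D ` K = {}"
    using separated_points_disjoint_cylinders[of "insert q (pt ` (\<F> \<times> UNIV))"] fin by blast
  have ex: "\<exists>C. C \<in> cylinders \<and> sim_ratio C \<le> \<delta> \<and> x \<in> sim_map C ` K" if "x \<in> K" for x
    using cylinder_of_ratio[OF that \<delta>(1)] \<delta>(2) by (metis less_imp_le)
  obtain U where U: "U \<in> cylinders" "sim_ratio U \<le> \<delta>" "q \<in> sim_map U ` K" using ex[OF q(1)] by blast
  have "\<forall>S\<in>\<F>. \<exists>C. C \<in> cylinders \<and> sim_ratio C \<le> \<delta> \<and> p S \<in> sim_map C ` K" using ex p(1) by blast
  from bchoice[OF this] obtain V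
    where V: "\<And>S. S \<in> \<F> \<Longrightarrow> V S \<in> cylinders" "\<And>S. S \<in> \<F> \<Longrightarrow> sim_ratio (V S) \<le> \<delta>"
      "\<And>S. S \<in> \<F> \<Longrightarrow> p S \<in> sim_map (V S) ` K" by blast
  define cyl where "cyl = (\<lambda>(S, b). if b then V S else sim_comp S (V S))"
  have cyl: "cyl i \<in> cylinders \<and> sim_ratio (cyl i) \<le> \<delta> \<and> pt i \<in> sim_map (cyl i) ` K" if i: "i \<in> \<F> \<times> UNIV" for i
  proof -
    obtain S b where Sb: "i = (S, b)" "S \<in> \<F>" using i by auto
    \<comment> \<open>Composing with the contraction S keeps the ratio below the threshold, so one
      \<delta> serves the cylinders and their images alike.\<close>
    have "sim_ratio S * sim_ratio (V S) \<le> 1 * \<delta>"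
      using contracting[OF Sb(2)] V(2)[OF Sb(2)] similarity_cylinder[OF V(1)[OF Sb(2)]]
      by (intro mult_mono) (auto simp: contracting_similarity_def similarity_def)
    then show ?thesis
      using V[OF Sb(2)] F_cylinder[OF Sb(2) V(1)[OF Sb(2)]]
      by (auto simp: cyl_def pt_def Sb(1) image_sim_map_comp)
  qed
  have disj: "sim_map (cyl i) ` K \<inter> sim_map (cyl j) ` K = {}"
    if "i \<in> \<F> \<times> UNIV" "j \<in> \<F> \<times> UNIV" "i \<noteq> j" for i j
    using \<delta>(3)[of "pt i" "pt j" "cyl i" "cyl j"] cyl[OF that(1)] cyl[OF that(2)] that
      inj_onD[OF inj, of i j] by blast
  show ?thesis
  proof (rule that[of "cyl ` (\<F> \<times> UNIV)" U])
    show "finite (cyl ` (\<F> \<times> UNIV))" using finite_F by simp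
    show "cyl ` (\<F> \<times> UNIV) \<subseteq> cylinders" using cyl by blast
    show "sim_ratio C < 1" if "C \<in> cyl ` (\<F> \<times> UNIV)" for C
      using that cyl \<delta>(2) by fastforce
    show "sim_map C ` K \<inter> sim_map D ` K = {}"
      if "C \<in> cyl ` (\<F> \<times> UNIV)" "D \<in> cyl ` (\<F> \<times> UNIV)" "C \<noteq> D" for C D
      using that disj by blast
    show "U \<in> cylinders" "sim_ratio U < 1" using U \<delta>(2) by auto
    show "sim_map C ` K \<inter> sim_map U ` K = {}" if C: "C \<in> cyl ` (\<F> \<times> UNIV)" for C
    proof -
      obtain i where i: "i \<in> \<F> \<times> UNIV" "C = cyl i" using C by blast
      then have "pt i \<noteq> q" using q(2) by blast
      then show ?thesis
        using \<delta>(3)[of "pt i" q C U] cyl[OF i(1)] U i by blast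
    qed
    show "\<exists>C\<in>cyl ` (\<F> \<times> UNIV). sim_comp S C \<in> cyl ` (\<F> \<times> UNIV) \<and> sim_comp S C \<noteq> C" if S: "S \<in> \<F>" for S
    proof -
      have i: "(S, True) \<in> \<F> \<times> UNIV" "(S, False) \<in> \<F> \<times> UNIV" using S by auto
      have "sim_map (cyl (S, True)) ` K \<inter> sim_map (cyl (S, False)) ` K = {}"
        using disj[OF i] by simp
      then have "cyl (S, False) \<noteq> cyl (S, True)" using K_nonempty by auto
      moreover have "cyl (S, False) = sim_comp S (cyl (S, True))" by (simp add: cyl_def)
      ultimately show ?thesis using i by (metis image_eqI)
    qed
  qed
qed

text \<open>The sum condition is conditional on \<open>0 \<le> t\<close> because a small dimension
  minus a margin may be negative; in that case only disjointness and the group matter.\<close>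

lemma separated_subsystem:
  assumes K: "infinite K" and t: "ereal t < hausdorff_dim K"
  obtains \<G> P Q where "finite \<G>" "\<G> \<subseteq> cylinders" "\<And>C. C \<in> \<G> \<Longrightarrow> sim_ratio C < 1"
    "\<And>C D. C \<in> \<G> \<Longrightarrow> D \<in> \<G> \<Longrightarrow> C \<noteq> D \<Longrightarrow> sim_map C ` K \<inter> sim_map D ` K = {}"
    "P \<in> \<G>" "Q \<in> \<G>" "P \<noteq> Q"
    "0 \<le> t \<Longrightarrow> 1 \<le> (\<Sum>C\<in>\<G>. sim_ratio C powr t)"
    "\<And>S. S \<in> \<F> \<Longrightarrow> \<exists>C\<in>\<G>. sim_comp S C \<in> \<G>"
proof -
  obtain \<G> U where G: "finite \<G>" "\<G> \<subseteq> cylinders" "\<And>C. C \<in> \<G> \<Longrightarrow> sim_ratio C < 1"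
    "\<And>C D. C \<in> \<G> \<Longrightarrow> D \<in> \<G> \<Longrightarrow> C \<noteq> D \<Longrightarrow> sim_map C ` K \<inter> sim_map D ` K = {}"
    "U \<in> cylinders" "sim_ratio U < 1" "\<And>C. C \<in> \<G> \<Longrightarrow> sim_map C ` K \<inter> sim_map U ` K = {}"
    "\<And>S. S \<in> \<F> \<Longrightarrow> \<exists>C\<in>\<G>. sim_comp S C \<in> \<G> \<and> sim_comp S C \<noteq> C"
    by (rule generating_disjoint_cylinders[OF K]) (rule that; assumption)
  have U: "similarity U" "0 < sim_ratio U" using similarity_cylinder[OF G(5)] by (auto simp: similarity_def)
  have "\<exists>\<W>. finite \<W> \<and> \<W> \<subseteq> cylinders \<and> (\<forall>C\<in>\<W>. sim_ratio C < 1) \<and>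
    (\<forall>C\<in>\<W>. \<forall>D\<in>\<W>. C \<noteq> D \<longrightarrow> sim_map C ` K \<inter> sim_map D ` K = {}) \<and>
    (0 \<le> t \<longrightarrow> sim_ratio U powr (- t) \<le> (\<Sum>C\<in>\<W>. sim_ratio C powr t))"
  proof (cases "0 \<le> t")
    case True
    then show ?thesis
      \<comment> \<open>Composition with U multiplies the sum by \<open>sim_ratio U powr t\<close>;
        this choice of M compensates exactly.\<close>
      using disjoint_cylinders_sum_ge[OF t True, of "sim_ratio U powr (- t)"] by simp
  next
    case False
    then show ?thesis by (intro exI[of _ "{}"]) auto
  qed
  then obtain \<W> where W': "finite \<W>" "\<W> \<subseteq> cylinders" "\<forall>C\<in>\<W>. sim_ratio C < 1"
    "\<forall>C\<in>\<W>. \<forall>D\<in>\<W>. C \<noteq> D \<longrightarrow> sim_map C ` K \<inter> sim_map D ` K = {}"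
    "0 \<le> t \<longrightarrow> sim_ratio U powr (- t) \<le> (\<Sum>C\<in>\<W>. sim_ratio C powr t)"
    by (elim exE conjE) (rule that)
  note W = W'(1,2) W'(3-5)[rule_format]
  have UW_sub: "sim_map (sim_comp U C) ` K \<subseteq> sim_map U ` K" if "C \<in> \<W>" for C
    using cylinder_image_subset[of C] W(2) that by (auto simp: image_sim_map_comp)
  have UW_disj: "sim_map (sim_comp U C) ` K \<inter> sim_map (sim_comp U D) ` K = {}"
    if "C \<in> \<W>" "D \<in> \<W>" "C \<noteq> D" for C D
    using W(4)[OF that] unfolding image_sim_map_comp image_Int[OF inj_sim_map[OF U(1)], symmetric]
    by simp
  \<comment> \<open>Needed to carry the sum over to the composites. Equal composites would have
    equal nonempty images, against their disjointness.\<close>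
  have inj: "inj_on (sim_comp U) \<W>"
  proof (rule inj_onI, rule ccontr)
    fix C D assume "C \<in> \<W>" "D \<in> \<W>" "sim_comp U C = sim_comp U D" "C \<noteq> D"
    then show False using UW_disj[of C D] K_nonempty by simp
  qed
  define \<H> where "\<H> = \<G> \<union> sim_comp U ` \<W>"
  obtain S where S: "S \<in> \<F>" using F_nonempty by blast
  obtain P where P: "P \<in> \<G>" "sim_comp S P \<in> \<G>" "sim_comp S P \<noteq> P" using G(8)[OF S] by blast
  show ?thesis
  proof (rule that[of \<H> P "sim_comp S P"])
    show fin: "finite \<H>" using G(1) W(1) by (simp add: \<H>_def)
    show cyl: "\<H> \<subseteq> cylinders" using G(2,5) W(2) comp_cylinder by (auto simp: \<H>_def)
    show "sim_ratio C < 1" if C: "C \<in> \<H>" for C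
    proof (cases "C \<in> \<G>")
      case False
      then obtain D where D: "D \<in> \<W>" "C = sim_comp U D" using C by (auto simp: \<H>_def)
      have "sim_ratio U * sim_ratio D < 1 * 1"
        using G(6) U(2) W(3)[OF D(1)] by (intro mult_strict_mono') (use similarity_cylinder W(2) D in
            \<open>auto simp: similarity_def less_imp_le\<close>)
      then show ?thesis using D by simp
    qed (simp add: G)
    show "sim_map C ` K \<inter> sim_map D ` K = {}" if "C \<in> \<H>" "D \<in> \<H>" "C \<noteq> D" for C D
    proof -
      have mixed: "sim_map C ` K \<inter> sim_map (sim_comp U D) ` K = {}" if "C \<in> \<G>" "D \<in> \<W>" for C D
        using G(7)[OF that(1)] UW_sub[OF that(2)] by blast
      show ?thesis using that unfolding \<H>_def
      proof (elim UnE imageE)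
        fix C' D' assume "C = sim_comp U C'" "C' \<in> \<W>" "D = sim_comp U D'" "D' \<in> \<W>"
        then show ?thesis using UW_disj[of C' D'] \<open>C \<noteq> D\<close> by metis
      qed (use G(4) mixed in \<open>simp_all add: Int_commute\<close>)
    qed
    show "P \<in> \<H>" "sim_comp S P \<in> \<H>" "P \<noteq> sim_comp S P" using P by (auto simp: \<H>_def)
    show "\<exists>C\<in>\<H>. sim_comp S C \<in> \<H>" if "S \<in> \<F>" for S using G(8)[OF that] by (auto simp: \<H>_def)
    assume "0 \<le> t"
    have "1 = sim_ratio U powr t * sim_ratio U powr (- t)" using U(2) by (simp add: powr_minus)
    also have "\<dots> \<le> sim_ratio U powr t * (\<Sum>C\<in>\<W>. sim_ratio C powr t)"
      using W(5) \<open>0 \<le> t\<close> by (intro mult_left_mono) auto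
    also have "\<dots> = (\<Sum>C\<in>\<W>. sim_ratio (sim_comp U C) powr t)"
      unfolding sum_distrib_left using U(2) W(2) similarity_cylinder
      by (intro sum.cong) (auto simp: similarity_def powr_mult less_imp_le subset_iff)
    also have "\<dots> = (\<Sum>C\<in>sim_comp U ` \<W>. sim_ratio C powr t)"
      by (simp add: sum.reindex[OF inj])
    also have "\<dots> \<le> (\<Sum>C\<in>\<H>. sim_ratio C powr t)"
      using fin by (intro sum_mono2) (auto simp: \<H>_def)
    finally show "1 \<le> (\<Sum>C\<in>\<H>. sim_ratio C powr t)" .
  qed
qed

text \<open>The orthogonal part of a cylinder is a product of generators, so passing to cylinders
  never enlarges the group. The second hypothesis is what prevents it from shrinking.\<close>

lemma generate_orth_cylinders:
  assumes "\<G> \<subseteq> cylinders" "\<And>S. S \<in> \<F> \<Longrightarrow> \<exists>C\<in>\<G>. sim_comp S C \<in> \<G>"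
  shows "generate orthogonal_group (sim_orth ` \<G>) = generate orthogonal_group (sim_orth ` \<F>)"
proof -
  interpret O: group "orthogonal_group :: ('a \<Rightarrow>\<^sub>L 'a) monoid" by (rule group_orthogonal_group)
  have orthF: "sim_orth ` \<F> \<subseteq> carrier orthogonal_group" using similarity_F by (auto simp: similarity_def)
  have orthG: "sim_orth ` \<G> \<subseteq> carrier orthogonal_group"
    using similarity_cylinder assms(1) by (auto simp: similarity_def)
  note subF = O.generate_is_subgroup[OF orthF] and subG = O.generate_is_subgroup[OF orthG]
  have mult: "f \<otimes>\<^bsub>orthogonal_group\<^esub> g = f o\<^sub>L g" for f g :: "'a \<Rightarrow>\<^sub>L 'a" by (simp add: orthogonal_group_def)
  have one: "\<one>\<^bsub>orthogonal_group\<^esub> = (id_blinfun :: 'a \<Rightarrow>\<^sub>L 'a)" by (simp add: orthogonal_group_def)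
  have "sim_orth C \<in> generate orthogonal_group (sim_orth ` \<F>)" if "C \<in> cylinders" for C
    using that
  proof (induction rule: cylinder_induct)
    case id
    then show ?case using subgroup.one_closed[OF subF] by (simp add: one)
  next
    case (comp S C)
    then show ?case
      using subgroup.m_closed[OF subF generate.incl[of "sim_orth S"] comp(3)] by (simp add: mult)
  qed
  then have 1: "sim_orth ` \<G> \<subseteq> generate orthogonal_group (sim_orth ` \<F>)" using assms(1) by blast
  have "sim_orth S \<in> generate orthogonal_group (sim_orth ` \<G>)" if S: "S \<in> \<F>" for S
  proof -
    obtain C where C: "C \<in> \<G>" "sim_comp S C \<in> \<G>" using assms(2)[OF S] by blast
    have "sim_orth (sim_comp S C) \<otimes>\<^bsub>orthogonal_group\<^esub> inv\<^bsub>orthogonal_group\<^esub> sim_orth C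
        \<in> generate orthogonal_group (sim_orth ` \<G>)"
      using C by (intro subgroup.m_closed[OF subG] subgroup.m_inv_closed[OF subG] generate.incl imageI)
    moreover have "sim_orth S \<in> carrier orthogonal_group" "sim_orth C \<in> carrier orthogonal_group"
      using orthF orthG S C by auto
    then have "sim_orth (sim_comp S C) \<otimes>\<^bsub>orthogonal_group\<^esub> inv\<^bsub>orthogonal_group\<^esub> sim_orth C = sim_orth S"
      using O.inv_solve_right[of "sim_orth S" "sim_orth (sim_comp S C)" "sim_orth C"]
        O.m_closed[of "sim_orth S" "sim_orth C"] by (simp add: mult)
    ultimately show ?thesis by simp
  qed
  then have 2: "sim_orth ` \<F> \<subseteq> generate orthogonal_group (sim_orth ` \<G>)" by blast
  show ?thesis
    using O.generate_subgroup_incl[OF 1 subF] O.generate_subgroup_incl[OF 2 subG] by blast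
qed

end

section \<open>Assembling the separated system\<close>

lemma UN_nth_eq_UN_set: "(\<Union>i<length xs. f (xs ! i)) = (\<Union>x\<in>set xs. f x)"
  by (auto simp: set_conv_nth)

theorem proposition1p8:
  fixes \<S> :: "(real ^ 'd) sim list" and K :: "(real ^ 'd) set" and \<epsilon> :: real
  assumes "ss_ifs \<S>"
    and "is_attractor \<S> K"
    and "\<exists>x\<in>K. \<exists>y\<in>K. x \<noteq> y"
    and "\<epsilon> > 0"
  shows "\<exists>(\<S>' :: (real ^ 'd) sim list) (K' :: (real ^ 'd) set).
    ss_ifs \<S>' \<and> is_attractor \<S>' K' \<and> strong_separation \<S>' K' \<and>
    K' \<subseteq> K \<and>
    hausdorff_dim K - ereal \<epsilon> < hausdorff_dim K' \<and>
    dense_subset_of (transformation_group \<S>') (transformation_group \<S>)"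
proof -
  interpret self_similar "set \<S>" K
  proof
    show "K = (\<Union>S\<in>set \<S>. sim_map S ` K)"
      using assms(2) unfolding is_attractor_def UN_nth_eq_UN_set[of "\<lambda>S. sim_map S ` K"] by (elim conjE)
  qed (use assms(1,2) in \<open>simp_all add: ss_ifs_def is_attractor_def\<close>)
  have inf: "infinite K" using assms(3) infinite_K by blast
  obtain d where d: "hausdorff_dim K = ereal d"
    using hausdorff_dim_K_less_top hausdorff_dim_nonneg[of K] by (cases "hausdorff_dim K") auto
  \<comment> \<open>Strictly between d - \<epsilon> and d: below d so that disjoint cylinders with
    large sums exist, above d - \<epsilon> so that the non-strict bound by t gives a strict
    one.\<close>
  define t where "t = d - \<epsilon> / 2"
  have "ereal t < hausdorff_dim K" using assms(4) d by (simp add: t_def)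
  then obtain \<G> P Q where G: "finite \<G>" "\<G> \<subseteq> cylinders" "\<And>C. C \<in> \<G> \<Longrightarrow> sim_ratio C < 1"
    "\<And>C D. C \<in> \<G> \<Longrightarrow> D \<in> \<G> \<Longrightarrow> C \<noteq> D \<Longrightarrow> sim_map C ` K \<inter> sim_map D ` K = {}"
    "P \<in> \<G>" "Q \<in> \<G>" "P \<noteq> Q"
    "0 \<le> t \<Longrightarrow> 1 \<le> (\<Sum>C\<in>\<G>. sim_ratio C powr t)"
    "\<And>S. S \<in> set \<S> \<Longrightarrow> \<exists>C\<in>\<G>. sim_comp S C \<in> \<G>"
    using separated_subsystem[OF inf] by blast
  have contr: "contracting_similarity C" if "C \<in> \<G>" for C
    using G(2,3) similarity_cylinder that by (auto simp: contracting_similarity_iff)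
  obtain L where L: "compact L" "L \<noteq> {}" "L \<subseteq> K" "L = (\<Union>S\<in>\<G>. sim_map S ` L)"
  proof (rule attractor_exists[of \<G> K])
    show "\<G> \<noteq> {}" using G(5) by blast
    show "sim_map S ` K \<subseteq> K" if "S \<in> \<G>" for S using cylinder_image_subset G(2) that by blast
  qed (use G(1) contr compact_K K_nonempty in \<open>auto simp: contracting_similarity_iff\<close>)
  have disj: "sim_map C ` L \<inter> sim_map D ` L = {}" if "C \<in> \<G>" "D \<in> \<G>" "C \<noteq> D" for C D
    using G(4)[OF that] L(3) by blast
  \<comment> \<open>Strong separation compares list positions, and a repeated map would meet itself
    because L is nonempty; hence an enumeration without repetitions.\<close>
  obtain \<S>' where S': "set \<S>' = \<G>" "distinct \<S>'" using finite_distinct_list[OF G(1)] by blast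
  have "hausdorff_dim K - ereal \<epsilon> < hausdorff_dim L"
  proof (cases "0 \<le> t")
    case True
    have "ereal t \<le> hausdorff_dim L"
      using L(4) by (intro hausdorff_dim_ge[OF G(1) contr L(1,2) _ G(5-7) disj G(8)[OF True]]) auto
    moreover have "hausdorff_dim K - ereal \<epsilon> < ereal t" using assms(4) d by (simp add: t_def)
    ultimately show ?thesis by (rule less_le_trans[rotated])
  next
    case False
    then have "hausdorff_dim K - ereal \<epsilon> < 0" using assms(4) d by (simp add: t_def)
    then show ?thesis using hausdorff_dim_nonneg by (rule less_le_trans)
  qed
  moreover have "ss_ifs \<S>'" using S' G(5) contr by (auto simp: ss_ifs_def)
  moreover have "is_attractor \<S>' L"
    using L S'(1) by (simp add: is_attractor_def UN_nth_eq_UN_set[of "\<lambda>S. sim_map S ` L"])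
  moreover have "strong_separation \<S>' L"
    unfolding strong_separation_def
  proof (intro allI impI)
    fix i j assume ij: "i < length \<S>'" "j < length \<S>'" "i \<noteq> j"
    then have "\<S>' ! i \<in> \<G>" "\<S>' ! j \<in> \<G>" "\<S>' ! i \<noteq> \<S>' ! j"
      using S' by (auto simp: nth_eq_iff_index_eq)
    then show "sim_map (\<S>' ! i) ` L \<inter> sim_map (\<S>' ! j) ` L = {}" by (rule disj)
  qed
  moreover have "transformation_group \<S>' = transformation_group \<S>"
    using generate_orth_cylinders[OF G(2,9)] S'(1) by (simp add: transformation_group_def)
  then have "dense_subset_of (transformation_group \<S>') (transformation_group \<S>)"
    by (simp add: dense_subset_of_def closure_subset)
  ultimately show ?thesis using L(3) by blast
qed

end
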